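(* Let $S=\langle g_1,\dots,g_n\rangle$ be a numerical semigroup and $R=K[[t^S]]$ with maximal ideal $\mathbf m$. Then $G(\mathbf m)$ is Cohen-Macaulay if and only if $a_i=b_i$ for those $i\in\{0,\dots,g_1-1\}$ such that $\omega_i\in\mathrm{maxAp}_M(S)$.
   Context: $K$ is an infinite field. A numerical semigroup $S\subseteq\mathbb N$ (with $0\in S$) has minimal generators $g_1<\dots<g_n$ with $\gcd(g_1,\dots,g_n)=1$. $R=K[[t^S]]=K[[t^{g_1},\dots,t^{g_n}]]$, $\mathbf m=(t^{g_1},\dots,t^{g_n})$, $G(\mathbf m)=\bigoplus_{i\ge0}\mathbf m^i/\mathbf m^{i+1}$. Apery set: $\mathrm{Ap}_{g_1}(S)=\{\omega_0,\dots,\omega_{g_1-1}\}$, where $\omega_i=\min\{s\in S: s\equiv i \bmod g_1\}$. Let $S'=\langle g_1,g_2-g_1,\dots,g_n-g_1\rangle$ and $\omega'_i=\min\{s\in S': s\equiv i\bmod g_1\}$. Let $M=S\setminus\{0\}$, $hM=M+\dots+M$ ($h$ summands), $0M=S$. For $0\le i\le g_1-1$, $a_i$ is the integer with $\omega'_i+a_ig_1=\omega_i$, and $b_i=\max\{l:\omega_i\in lM\}$; one always has $b_i\le a_i$. For $s\in S$, $\mathrm{ord}(s)=h$ if $s\in hM\setminus(h+1)M$. Partial order on $S$: $u\le_M u'$ if there is $s\in S$ with $u+s=u'$ and $\mathrm{ord}(u)+\mathrm{ord}(s)=\mathrm{ord}(u')$. $\mathrm{maxAp}_M(S)$ is the set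 of maximal elements of $\mathrm{Ap}_{g_1}(S)$ with respect to $\le_M$. *)

theory Defs
  imports
    "HOL-Algebra.Ideal_Product"
    "HOL-Algebra.Ring_Divisibility"
    "HOL-Computational_Algebra.Formal_Power_Series"
    "HOL-Library.Extended_Nat"
begin

section \<open>Numerical semigroups\<close>

inductive_set semigroup_span :: "nat set \<Rightarrow> nat set" for A where
  zero: "0 \<in> semigroup_span A"
| add: "a \<in> A \<Longrightarrow> s \<in> semigroup_span A \<Longrightarrow> a + s \<in> semigroup_span A"

text \<open>The semigroup \<open>\<langle>g\<^sub>1, g\<^sub>2 - g\<^sub>1, \<dots>, g\<^sub>n - g\<^sub>1\<rangle>\<close> for an increasing list \<open>[g\<^sub>1, \<dots>, g\<^sub>n]\<close>;
  only \<open>g\<^sub>1\<close> itself is not shifted.\<close>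

definition shifted_semigroup :: "nat list \<Rightarrow> nat set" where
  "shifted_semigroup gs = semigroup_span (insert (hd gs) ((\<lambda>g. g - hd gs) ` set (tl gs)))"

definition apery :: "nat set \<Rightarrow> nat \<Rightarrow> nat \<Rightarrow> nat" where
  "apery S m i = (LEAST s. s \<in> S \<and> s mod m = i mod m)"

definition apery_set :: "nat set \<Rightarrow> nat \<Rightarrow> nat set" where
  "apery_set S m = apery S m ` {..<m}"

definition mult_M :: "nat set \<Rightarrow> nat \<Rightarrow> nat set" where
  "mult_M S h = (if h = 0 then S
     else {sum_list xs | xs. length xs = h \<and> set xs \<subseteq> S - {0}})"

definition ord_M :: "nat set \<Rightarrow> nat \<Rightarrow> nat" where
  "ord_M S s = (THE h. s \<in> mult_M S h \<and> s \<notin> mult_M S (h + 1))"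

definition le_M :: "nat set \<Rightarrow> nat \<Rightarrow> nat \<Rightarrow> bool" where
  "le_M S u u' \<longleftrightarrow> (\<exists>s\<in>S. u + s = u' \<and> ord_M S u + ord_M S s = ord_M S u')"

definition max_apery_M :: "nat set \<Rightarrow> nat \<Rightarrow> nat set" where
  "max_apery_M S m =
     {w \<in> apery_set S m. \<forall>w'\<in>apery_set S m. le_M S w w' \<longrightarrow> w' = w}"

definition a_num :: "nat list \<Rightarrow> nat \<Rightarrow> int" where
  "a_num gs i = (THE a. int (apery (shifted_semigroup gs) (hd gs) i) + a * int (hd gs)
                      = int (apery (semigroup_span (set gs)) (hd gs) i))"

definition b_num :: "nat list \<Rightarrow> nat \<Rightarrow> nat" where
  "b_num gs i = Max {l. apery (semigroup_span (set gs)) (hd gs) i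
                        \<in> mult_M (semigroup_span (set gs)) l}"


section \<open>The ring \<open>K[[t\<^sup>S]]\<close> and its maximal ideal\<close>

text \<open>\<open>K[[t\<^sup>S]]\<close> is the subring of \<open>K[[t]]\<close> of the power series supported on \<open>S\<close>.\<close>

definition semigroup_ring :: "nat set \<Rightarrow> 'k::field fps ring" where
  "semigroup_ring S =
     \<lparr>carrier = {f. \<forall>n. fps_nth f n \<noteq> 0 \<longrightarrow> n \<in> S},
      monoid.mult = (*), one = 1, ring.zero = 0, add = (+)\<rparr>"

definition semigroup_ideal :: "nat list \<Rightarrow> 'k::field fps set" where
  "semigroup_ideal gs =
     genideal (semigroup_ring (semigroup_span (set gs))) ((\<lambda>g. fps_X ^ g) ` set gs)"


section \<open>The associated graded ring of an ideal\<close>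

abbreviation ideal_power :: "('a, 'b) ring_scheme \<Rightarrow> 'a set \<Rightarrow> nat \<Rightarrow> 'a set" where
  "ideal_power R I n \<equiv> I [^]\<^bsub>ideals_set R\<^esub> n"

text \<open>An element of \<open>\<Oplus>\<^sub>i I\<^sup>i / I\<^sup>i\<^sup>+\<^sup>1\<close> is the sequence \<open>u\<close> of its homogeneous components:
  \<open>u i\<close> is a coset \<open>I\<^sup>i\<^sup>+\<^sup>1 + a\<close> with \<open>a \<in> I\<^sup>i\<close>, and is zero (the coset \<open>I\<^sup>i\<^sup>+\<^sup>1\<close>) for all but
  finitely many \<open>i\<close>.  The product of the classes of \<open>a \<in> I\<^sup>i\<close> and \<open>b \<in> I\<^sup>j\<close> is the class of
  \<open>ab\<close> modulo \<open>I\<^sup>i\<^sup>+\<^sup>j\<^sup>+\<^sup>1\<close>; the degree \<open>k\<close> component of a product is computed in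
  \<open>R / I\<^sup>k\<^sup>+\<^sup>1\<close>, which contains \<open>I\<^sup>k / I\<^sup>k\<^sup>+\<^sup>1\<close>.\<close>

definition assoc_graded :: "('a, 'b) ring_scheme \<Rightarrow> 'a set \<Rightarrow> (nat \<Rightarrow> 'a set) ring" where
  "assoc_graded R I =
     \<lparr>carrier = {u. (\<forall>i. u i \<in> (\<lambda>a. ideal_power R I (i + 1) +>\<^bsub>R\<^esub> a) ` ideal_power R I i)
                    \<and> finite {i. u i \<noteq> ideal_power R I (i + 1)}},
      monoid.mult = (\<lambda>u v k. finsum (R Quot ideal_power R I (k + 1))
                 (\<lambda>i. rcoset_mult R (ideal_power R I (k + 1)) (u i) (v (k - i))) {..k}),
      one = (\<lambda>i. if i = 0 then ideal_power R I 1 +>\<^bsub>R\<^esub> \<one>\<^bsub>R\<^esub> else ideal_power R I (i + 1)),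
      ring.zero = (\<lambda>i. ideal_power R I (i + 1)),
      add = (\<lambda>u v i. u i <+>\<^bsub>R\<^esub> v i)\<rparr>"


section \<open>Cohen-Macaulay rings\<close>

text \<open>\<open>x\<^sub>1, \<dots>, x\<^sub>r\<close> is a regular sequence on \<open>R\<close>: it generates a proper ideal, and each \<open>x\<^sub>i\<close> is a
  nonzerodivisor on \<open>R / (x\<^sub>1, \<dots>, x\<^sub>i\<^sub>-\<^sub>1)\<close>, written out on representatives.\<close>

definition regular_seq :: "('a, 'b) ring_scheme \<Rightarrow> 'a list \<Rightarrow> bool" where
  "regular_seq R xs \<longleftrightarrow>
     set xs \<subseteq> carrier R \<and> genideal R (set xs) \<noteq> carrier R \<and>
     (\<forall>i<length xs. \<forall>a\<in>carrier R.
        xs ! i \<otimes>\<^bsub>R\<^esub> a \<in> genideal R (set (take i xs)) \<longrightarrow> a \<in> genideal R (set (take i xs)))"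

definition ideal_depth :: "('a, 'b) ring_scheme \<Rightarrow> 'a set \<Rightarrow> enat" where
  "ideal_depth R I = Sup {enat (length xs) | xs. regular_seq R xs \<and> set xs \<subseteq> I}"

text \<open>The height (codimension) of a prime \<open>P\<close>: the supremum of the lengths \<open>n\<close> of chains
  \<open>P\<^sub>0 \<subset> \<dots> \<subset> P\<^sub>n = P\<close> of primes.\<close>

definition prime_height :: "('a, 'b) ring_scheme \<Rightarrow> 'a set \<Rightarrow> enat" where
  "prime_height R P = Sup {enat n | n ps. length ps = n + 1 \<and> sorted_wrt (\<subset>) ps \<and>
                             (\<forall>Q\<in>set ps. primeideal Q R) \<and> last ps = P}"

text \<open>The definition of Eisenbud, Commutative Algebra, 18.2: a Noetherian ring in which the
  depth of every maximal ideal equals its codimension.\<close>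

definition cohen_macaulay :: "('a, 'b) ring_scheme \<Rightarrow> bool" where
  "cohen_macaulay R \<longleftrightarrow> cring R \<and> noetherian_ring R \<and>
     (\<forall>P. maximalideal P R \<longrightarrow> ideal_depth R P = prime_height R P)"

end

theory Submission
  imports Defs "HOL-Computational_Algebra.Polynomial"
begin

text \<open>The ring \<open>G(\<m>)\<close> has a \<open>K\<close>-basis \<open>x\<^sup>s\<close>, \<open>s \<in> S\<close>, with \<open>x\<^sup>s x\<^sup>t = x\<^sup>s\<^sup>+\<^sup>t\<close> if \<open>ord(s) + ord(t) = ord(s + t)\<close>
  and \<open>x\<^sup>s x\<^sup>t = 0\<close> otherwise. Let \<open>T\<close> be the class of \<open>t\<^sup>g\<close> for \<open>g = g\<^sub>1\<close>. All other generators are nilpotent, so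
  \<open>G(\<m>)\<close> is a finite extension of \<open>K[T]\<close> which becomes \<open>K[T]\<close> modulo nilpotents. Hence every maximal ideal has
  height 1, no regular sequence has length 2, and \<open>G(\<m>)\<close> is Cohen-Macaulay if and only if \<open>T\<close> is a
  nonzerodivisor: a nonzerodivisor in the homogeneous maximal ideal has a power in \<open>(T)\<close>, and conversely
  each nonzero polynomial in \<open>T\<close> is then a nonzerodivisor. In the basis this says that
  \<open>ord(s + g) = ord(s) + 1\<close> for all \<open>s\<close>, which is equivalent to \<open>a\<^sub>i = b\<^sub>i\<close> for all \<open>i\<close>; and equality at a
  \<open>\<le>\<^sub>M\<close>-maximal element forces equality at all elements below it.\<close>

section \<open>Polynomials in one variable over a field\<close>

text \<open>\<open>cohen_macaulay\<close> ranges over all maximal ideals of a ring that is not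
  local, so the homogeneous one alone does not suffice. The way out is the section from K[X] and the
  retraction onto it with nil kernel: heights and lengths of regular sequences then reduce to gcd
  computations in K[X]. The other generators are nilpotent because s - m ord(s), with m = g_1, is
  additive on nonzero products of monomials, bounded on S, and zero only at the multiples of m. The
  orders are tied to the a_i by one description of S': v is in S' iff v + h m lies in hM for some h.
  Hence s - m ord(s) lies in S', which bounds orders from above, while the elements
  \<open>\<omega>' i + h * m\<close> of hM bound them from below. Cosets of ideals are awkward to
  compute with, so the monomial basis is made into a ring of its own, with a truncated convolution,
  and an explicit isomorphism carries the results over.\<close>

lemma poly_ideal_principal:
  fixes I :: "'k::field poly set"
  assumes zero: "0 \<in> I"
    and add: "\<And>p q. p \<in> I \<Longrightarrow> q \<in> I \<Longrightarrow> p + q \<in> I"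
    and mult: "\<And>p q. p \<in> I \<Longrightarrow> q * p \<in> I"
  obtains d where "d \<in> I" "\<And>p. p \<in> I \<Longrightarrow> d dvd p"
proof (cases "I \<subseteq> {0}")
  case True
  then show ?thesis using zero that[of 0] by auto
next
  case False
  then obtain p0 where p0: "p0 \<in> I \<and> p0 \<noteq> 0" by auto
  define d where "d = (ARG_MIN degree p. p \<in> I \<and> p \<noteq> 0)"
  have d: "d \<in> I \<and> d \<noteq> 0" unfolding d_def
    by (rule arg_min_natI[where k = p0]) (rule p0)
  have dmin: "degree d \<le> degree p" if "p \<in> I" "p \<noteq> 0" for p
    unfolding d_def by (rule arg_min_nat_le) (use that in auto)
  have "d dvd p" if "p \<in> I" for p
  proof -
    have eq: "p mod d = p + (- (p div d)) * d"
      by (metis add_uminus_conv_diff minus_div_mult_eq_mod mult_minus_left)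
    have "p mod d \<in> I"
      unfolding eq by (intro add mult that) (use d in auto)
    moreover have "p mod d = 0 \<or> degree (p mod d) < degree d"
      using d degree_mod_less[of d p] by auto
    ultimately have "p mod d = 0" using dmin by (metis not_le)
    then show ?thesis by auto
  qed
  with d that show ?thesis by blast
qed

text \<open>Euclid's algorithm removes from f the factors shared with h: with d = gcd(f, h), f is
  replaced by f / d, whose degree is smaller unless d is a unit. The outcome f' is coprime to h
  while f still divides f' h^e, so no factorisation into irreducibles is required.\<close>

lemma poly_coprime_part:
  fixes f h :: "'k::field poly"
  assumes "f \<noteq> 0"
  obtains f' e q u v where "f' * h ^ e = f * q" "u * f' + v * h = 1"
proof -
  have "\<exists>f' e q u v. f' * h ^ e = f * q \<and> u * f' + v * h = 1"
    using assms
  proof (induction "degree f" arbitrary: f rule: less_induct)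
    case less
    define I where "I = {u * f + v * h | u v. True}"
    obtain d where dI: "d \<in> I" and dd: "\<And>p. p \<in> I \<Longrightarrow> d dvd p"
    proof (rule poly_ideal_principal[of I])
      show "0 \<in> I" unfolding I_def by (rule CollectI, rule exI[of _ 0], rule exI[of _ 0]) simp
      show "p + q \<in> I" if "p \<in> I" "q \<in> I" for p q
      proof -
        obtain u v where p: "p = u * f + v * h" using \<open>p \<in> I\<close> unfolding I_def by blast
        obtain u' v' where q: "q = u' * f + v' * h" using \<open>q \<in> I\<close> unfolding I_def by blast
        from p q have "p + q = (u + u') * f + (v + v') * h" by (simp add: algebra_simps)
        then show ?thesis unfolding I_def by blast
      qed
      show "q * p \<in> I" if "p \<in> I" for p q
      proof -
        obtain u v where "p = u * f + v * h"
          using \<open>p \<in> I\<close> unfolding I_def by blast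
        then have "q * p = (q * u) * f + (q * v) * h" by (simp add: algebra_simps)
        then show ?thesis unfolding I_def by blast
      qed
    qed blast
    obtain u v where duv: "d = u * f + v * h" using dI unfolding I_def by auto
    have "f \<in> I" unfolding I_def by (rule CollectI, rule exI[of _ 1], rule exI[of _ 0]) simp
    then obtain f1 where f1: "f = d * f1" using dd by (meson dvdE)
    have "h \<in> I" unfolding I_def by (rule CollectI, rule exI[of _ 0], rule exI[of _ 1]) simp
    then obtain h1 where h1: "h = d * h1" using dd by (meson dvdE)
    have nz: "d \<noteq> 0" "f1 \<noteq> 0" using less.prems f1 by auto
    show ?case
    proof (cases "degree d = 0")
      case True
      then obtain c where c: "d = [:c:]" by (meson degree_eq_zeroE)
      with nz have "c \<noteq> 0" by auto
      then have "[:1 / c:] * d = 1" using c by (simp add: one_pCons)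
      then have "([:1 / c:] * u) * f + ([:1 / c:] * v) * h = 1"
        unfolding duv by (simp only: distrib_left mult.assoc)
      then show ?thesis
        by (intro exI[of _ f] exI[of _ "0::nat"] exI[of _ "1::'k poly"]
            exI[of _ "[:1 / c:] * u"] exI[of _ "[:1 / c:] * v"]) simp
    next
      case False
      have "degree f = degree d + degree f1" using f1 nz by (simp add: degree_mult_eq)
      then obtain f' e q u v where IH: "f' * h ^ e = f1 * q" "u * f' + v * h = 1"
        using less.hyps[of f1] nz False by auto
      have "f' * h ^ Suc e = h * (f' * h ^ e)" by (simp add: algebra_simps)
      also have "\<dots> = f * (h1 * q)" unfolding IH(1) by (simp add: h1 f1 algebra_simps)
      finally show ?thesis using IH(2) by blast
    qed
  qed
  with that show ?thesis by blast
qed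

text \<open>1 - u f' = v h divides 1 - (u f')^k, so coprimality to h survives powers of f'. Powers
  come in because equality modulo the nil kernel yields ideal membership only after taking a
  power.\<close>

lemma poly_bezout_power:
  fixes f f' h :: "'k::field poly"
  assumes "u * f' + v * h = 1"
  obtains w where "u ^ k * f' ^ k + w * h = 1"
proof -
  have "1 - u * f' dvd 1 - (u * f') ^ k"
    by (simp add: one_diff_power_eq)
  moreover have "1 - u * f' = v * h" using assms by (simp add: algebra_simps)
  ultimately obtain w where "1 - (u * f') ^ k = v * h * w" by (metis dvdE)
  then have "u ^ k * f' ^ k + (v * w) * h = 1"
    by (simp add: power_mult_distrib algebra_simps)
  then show ?thesis by (rule that)
qed

section \<open>Nil extensions of a polynomial ring\<close>

definition poly_ring :: "'k::field poly ring" where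
  "poly_ring = \<lparr>carrier = UNIV, monoid.mult = (*), one = 1, ring.zero = 0, add = (+)\<rparr>"

text \<open>The K[X]-submodule generated by \<open>W\<close>, with K[X] acting through
  \<open>\<sigma>\<close>. Linear combinations grow by one summand at a time and may reuse a
  generator, which keeps closure under sums a plain induction.\<close>

inductive_set poly_span :: "('a, 'b) ring_scheme \<Rightarrow> ('k::field poly \<Rightarrow> 'a) \<Rightarrow> 'a set \<Rightarrow> 'a set"
  for G \<sigma> W where
  zero: "\<zero>\<^bsub>G\<^esub> \<in> poly_span G \<sigma> W"
| add: "w \<in> W \<Longrightarrow> v \<in> poly_span G \<sigma> W \<Longrightarrow> (\<sigma> p \<otimes>\<^bsub>G\<^esub> w) \<oplus>\<^bsub>G\<^esub> v \<in> poly_span G \<sigma> W"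

locale poly_algebra = cring G for G (structure) +
  fixes \<sigma> :: "'k::field poly \<Rightarrow> 'a"
  assumes sec_hom: "\<sigma> \<in> ring_hom poly_ring G"
begin

lemma sec_closed [simp]: "\<sigma> p \<in> carrier G"
  using ring_hom_closed[OF sec_hom] by (simp add: poly_ring_def)

lemma sec_add: "\<sigma> (p + q) = \<sigma> p \<oplus> \<sigma> q"
  using ring_hom_add[OF sec_hom, of p q] by (simp add: poly_ring_def)

lemma sec_mult: "\<sigma> (p * q) = \<sigma> p \<otimes> \<sigma> q"
  using ring_hom_mult[OF sec_hom, of p q] by (simp add: poly_ring_def)

lemma sec_one [simp]: "\<sigma> 1 = \<one>"
  using ring_hom_one[OF sec_hom] by (simp add: poly_ring_def)

lemma sec_zero [simp]: "\<sigma> 0 = \<zero>"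
  using sec_add[of 0 0] by (simp add: add.l_cancel_one)

lemma sec_power: "\<sigma> (p ^ k) = \<sigma> p [^] k"
  by (induction k) (auto simp: sec_mult m_comm)

lemma poly_span_closed:
  assumes "W \<subseteq> carrier G" "v \<in> poly_span G \<sigma> W"
  shows "v \<in> carrier G"
  using assms(2) by induction (use assms(1) in auto)

lemma poly_span_add:
  assumes "W \<subseteq> carrier G" "v \<in> poly_span G \<sigma> W" "v' \<in> poly_span G \<sigma> W"
  shows "v \<oplus> v' \<in> poly_span G \<sigma> W"
  using assms(2)
proof induction
  case zero
  then show ?case using assms poly_span_closed by auto
next
  case (add w v p)
  have "(\<sigma> p \<otimes> w \<oplus> v) \<oplus> v' = \<sigma> p \<otimes> w \<oplus> (v \<oplus> v')"
    using add assms poly_span_closed[OF assms(1)] by (intro a_assoc) auto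
  then show ?case using poly_span.add[OF add(1) add(3)] by simp
qed

lemma poly_span_smult:
  assumes "W \<subseteq> carrier G" "v \<in> poly_span G \<sigma> W"
  shows "\<sigma> q \<otimes> v \<in> poly_span G \<sigma> W"
  using assms(2)
proof induction
  case zero
  then show ?case by (simp add: poly_span.zero)
next
  case (add w v p)
  have "w \<in> carrier G" "v \<in> carrier G" using add assms poly_span_closed by auto
  then have "\<sigma> q \<otimes> (\<sigma> p \<otimes> w \<oplus> v) = \<sigma> (q * p) \<otimes> w \<oplus> \<sigma> q \<otimes> v"
    by (simp add: sec_mult r_distr m_assoc)
  then show ?case using poly_span.add[OF add(1) add(3)] by simp
qed

lemma poly_span_mono:
  assumes "W \<subseteq> W'" shows "poly_span G \<sigma> W \<subseteq> poly_span G \<sigma> W'"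
proof
  fix v assume "v \<in> poly_span G \<sigma> W"
  then show "v \<in> poly_span G \<sigma> W'"
    by induction (use assms in \<open>auto intro: poly_span.intros\<close>)
qed

lemma poly_span_insertE:
  assumes "insert w W \<subseteq> carrier G" "v \<in> poly_span G \<sigma> (insert w W)"
  obtains p v' where "v' \<in> poly_span G \<sigma> W" "v = \<sigma> p \<otimes> w \<oplus> v'"
proof -
  have "\<exists>p. \<exists>v'\<in>poly_span G \<sigma> W. v = \<sigma> p \<otimes> w \<oplus> v'" using assms(2)
  proof induction
    case zero
    show ?case by (rule exI[of _ 0]) (use assms in \<open>auto intro!: bexI[of _ \<zero>] poly_span.zero\<close>)
  next
    case (add x v q)
    then obtain p v' where v': "v' \<in> poly_span G \<sigma> W" "v = \<sigma> p \<otimes> w \<oplus> v'" by blast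
    have c: "w \<in> carrier G" "x \<in> carrier G" "v' \<in> carrier G"
      using assms(1) add(1) v'(1) poly_span_closed[of W v'] by auto
    show ?case
    proof (cases "x = w")
      case True
      have "\<sigma> q \<otimes> x \<oplus> v = \<sigma> (q + p) \<otimes> w \<oplus> v'"
        using c by (simp add: True v'(2) sec_add l_distr a_assoc)
      then show ?thesis using v'(1) by blast
    next
      case False
      then have "\<sigma> q \<otimes> x \<oplus> v' \<in> poly_span G \<sigma> W" using add(1) v'(1) by (auto intro: poly_span.add)
      moreover have "\<sigma> q \<otimes> x \<oplus> v = \<sigma> p \<otimes> w \<oplus> (\<sigma> q \<otimes> x \<oplus> v')"
        unfolding v'(2) using c by (simp add: a_lcomm)
      ultimately show ?thesis by blast
    qed
  qed
  with that show ?thesis by blast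
qed

text \<open>Submodules of a finitely generated module over the principal ideal domain \<open>K[X]\<close> are
  finitely generated: split off one generator at a time, using that the coefficients of that
  generator form an ideal of \<open>K[X]\<close>.\<close>

lemma submodule_fg:
  assumes "finite W" "W \<subseteq> carrier G" "J \<subseteq> poly_span G \<sigma> W" "\<zero> \<in> J"
    and "\<And>a b. a \<in> J \<Longrightarrow> b \<in> J \<Longrightarrow> a \<oplus> b \<in> J"
    and "\<And>a p. a \<in> J \<Longrightarrow> \<sigma> p \<otimes> a \<in> J"
  shows "\<exists>B. finite B \<and> B \<subseteq> J \<and> J \<subseteq> poly_span G \<sigma> B"
  using assms
proof (induction W arbitrary: J rule: finite_induct)
  case empty
  have "v = \<zero>" if "v \<in> poly_span G \<sigma> {}" for v
    using that by induction auto
  then have "J \<subseteq> {\<zero>}" using empty by auto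
  then show ?case by (intro exI[of _ "{}"]) (auto intro: poly_span.zero)
next
  case (insert w W)
  note J0 = insert.prems(3) and Jadd = insert.prems(4) and Jmult = insert.prems(5)
  have wc: "w \<in> carrier G" "W \<subseteq> carrier G" using insert.prems(1) by auto
  have Jc: "a \<in> carrier G" if "a \<in> J" for a
    using that insert.prems(1,2) poly_span_closed by blast
  \<comment> \<open>The coefficients of w in elements of J form an ideal of K[X]; its generator d is
    attained by \<open>j0\<close> below.\<close>
  define I where "I = {p. \<exists>v\<in>poly_span G \<sigma> W. \<sigma> p \<otimes> w \<oplus> v \<in> J}"
  obtain d where dI: "d \<in> I" and dd: "\<And>p. p \<in> I \<Longrightarrow> d dvd p"
  proof (rule poly_ideal_principal[of I])
    show "0 \<in> I" unfolding I_def
      by (rule CollectI, rule bexI[of _ \<zero>]) (use wc J0 in \<open>auto intro: poly_span.zero\<close>)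
    show "p + q \<in> I" if pq: "p \<in> I" "q \<in> I" for p q
    proof -
      obtain v where v: "v \<in> poly_span G \<sigma> W" "\<sigma> p \<otimes> w \<oplus> v \<in> J"
        using pq unfolding I_def by blast
      obtain v' where v': "v' \<in> poly_span G \<sigma> W" "\<sigma> q \<otimes> w \<oplus> v' \<in> J"
        using pq unfolding I_def by blast
      have "v \<in> carrier G" "v' \<in> carrier G" using v v' wc poly_span_closed by auto
      then have "\<sigma> (p + q) \<otimes> w \<oplus> (v \<oplus> v') = (\<sigma> p \<otimes> w \<oplus> v) \<oplus> (\<sigma> q \<otimes> w \<oplus> v')"
        using wc sec_closed[of p] sec_closed[of q] unfolding sec_add by algebra
      with Jadd[OF v(2) v'(2)] have "\<sigma> (p + q) \<otimes> w \<oplus> (v \<oplus> v') \<in> J" by simp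
      with poly_span_add[OF wc(2) v(1) v'(1)] show ?thesis unfolding I_def by blast
    qed
    show "q * p \<in> I" if p: "p \<in> I" for p q
    proof -
      obtain v where v: "v \<in> poly_span G \<sigma> W" "\<sigma> p \<otimes> w \<oplus> v \<in> J"
        using p unfolding I_def by blast
      have "v \<in> carrier G" using v wc poly_span_closed by auto
      then have "\<sigma> (q * p) \<otimes> w \<oplus> \<sigma> q \<otimes> v = \<sigma> q \<otimes> (\<sigma> p \<otimes> w \<oplus> v)"
        using wc sec_closed[of p] sec_closed[of q] unfolding sec_mult by algebra
      with Jmult[OF v(2), of q] have "\<sigma> (q * p) \<otimes> w \<oplus> \<sigma> q \<otimes> v \<in> J" by simp
      with poly_span_smult[OF wc(2) v(1)] show ?thesis unfolding I_def by blast
    qed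
  qed blast
  obtain v0 where v0: "v0 \<in> poly_span G \<sigma> W" "\<sigma> d \<otimes> w \<oplus> v0 \<in> J"
    using dI unfolding I_def by blast
  define j0 where "j0 = \<sigma> d \<otimes> w \<oplus> v0"
  have v0c: "v0 \<in> carrier G" using v0 wc poly_span_closed by auto
  obtain B where B: "finite B" "B \<subseteq> J \<inter> poly_span G \<sigma> W" "J \<inter> poly_span G \<sigma> W \<subseteq> poly_span G \<sigma> B"
    using insert.IH[of "J \<inter> poly_span G \<sigma> W"] wc J0 Jadd Jmult
      poly_span_add[OF wc(2)] poly_span_smult[OF wc(2)]
    by (auto intro: poly_span.zero)
  have "J \<subseteq> poly_span G \<sigma> (insert j0 B)"
  proof
    fix a assume a: "a \<in> J"
    obtain p v where v: "v \<in> poly_span G \<sigma> W" "a = \<sigma> p \<otimes> w \<oplus> v"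
      using a insert.prems(2) poly_span_insertE[OF insert.prems(1)] by blast
    have vc: "v \<in> carrier G" using v wc poly_span_closed by auto
    have "p \<in> I" using a v unfolding I_def by blast
    then obtain q where q: "p = d * q" using dd by (meson dvdE)
    have neg: "\<sigma> (- q) \<oplus> \<sigma> q = \<zero>" using sec_add[of "- q" q] by simp
    \<comment> \<open>r = a - q j0: the coefficient p = d q of w cancels, so r lies in J and in the
      span of W, which B already covers.\<close>
    define r where "r = \<sigma> (- q) \<otimes> v0 \<oplus> v"
    have "r \<in> poly_span G \<sigma> W" unfolding r_def
      by (intro poly_span_add poly_span_smult wc v0 v)
    moreover
    have neg': "\<sigma> (- q) = \<ominus> \<sigma> q" using neg by (simp add: minus_equality)
    have r2: "r = \<sigma> (- q) \<otimes> j0 \<oplus> a"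
      using vc v0c wc sec_closed[of d] sec_closed[of q] sec_closed[of p]
      unfolding r_def neg' j0_def v(2) q sec_mult by algebra
    have "r \<in> J" unfolding r2 by (intro Jadd Jmult a) (use v0 in \<open>simp add: j0_def\<close>)
    ultimately have "r \<in> poly_span G \<sigma> (insert j0 B)"
      using B(3) poly_span_mono[of B "insert j0 B"] by blast
    then have "\<sigma> q \<otimes> j0 \<oplus> r \<in> poly_span G \<sigma> (insert j0 B)"
      by (intro poly_span.add) auto
    moreover have "\<sigma> q \<otimes> j0 \<oplus> r = a"
      unfolding r2 neg' using Jc[OF a] vc v0c wc sec_closed[of d] sec_closed[of q]
      unfolding j0_def by algebra
    ultimately show "a \<in> poly_span G \<sigma> (insert j0 B)" by simp
  qed
  then show ?case using B v0 by (intro exI[of _ "insert j0 B"]) (auto simp: j0_def)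
qed

lemma noetherian_if_fg:
  assumes "finite W" "W \<subseteq> carrier G" "carrier G \<subseteq> poly_span G \<sigma> W"
  shows "noetherian_ring G"
proof (rule noetherian_ringI)
  fix J assume J: "ideal J G"
  interpret J: ideal J G by fact
  obtain B where B: "finite B" "B \<subseteq> J" "J \<subseteq> poly_span G \<sigma> B"
  proof -
    have "J \<subseteq> poly_span G \<sigma> W" using assms(3) J.Icarr by auto
    with that show ?thesis
      using submodule_fg[OF assms(1,2) _ J.zero_closed J.a_closed J.I_l_closed[OF _ sec_closed]]
      by blast
  qed
  have Bc: "B \<subseteq> carrier G" using B(2) J.Icarr by auto
  interpret B: ideal "Idl B" G using genideal_ideal[OF Bc] .
  have "v \<in> Idl B" if "v \<in> poly_span G \<sigma> B" for v
    using that
  proof induction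
    case (add w v p)
    then have "w \<in> Idl B" using genideal_self[OF Bc] by auto
    then show ?case using add by (simp add: B.I_l_closed)
  qed simp
  then have "J = Idl B" using B genideal_minimal[OF J B(2)] by auto
  then show "\<exists>A\<subseteq>carrier G. finite A \<and> J = Idl A" using B Bc by blast
qed

end

section \<open>Nonzerodivisors and powers modulo ideals\<close>

definition nzd :: "('a, 'b) ring_scheme \<Rightarrow> 'a \<Rightarrow> bool" where
  "nzd R x \<longleftrightarrow> (\<forall>a\<in>carrier R. x \<otimes>\<^bsub>R\<^esub> a = \<zero>\<^bsub>R\<^esub> \<longrightarrow> a = \<zero>\<^bsub>R\<^esub>)"

lemma (in cring) nzd_power:
  assumes "x \<in> carrier R" "nzd R x"
  shows "nzd R (x [^] (k::nat))"
proof (induction k)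
  case 0
  then show ?case by (simp add: nzd_def)
next
  case (Suc k)
  have "a = \<zero>" if "a \<in> carrier R" "x [^] Suc k \<otimes> a = \<zero>" for a
  proof -
    have "x [^] k \<otimes> (x \<otimes> a) = \<zero>" using that assms by (simp add: m_assoc)
    then have "x \<otimes> a = \<zero>" using Suc that assms unfolding nzd_def by (meson m_closed)
    then show ?thesis using assms that unfolding nzd_def by simp
  qed
  then show ?case unfolding nzd_def by blast
qed

lemma (in ideal) power_minus_power:
  fixes k :: nat
  assumes "cring R" "x \<in> carrier R" "y \<in> carrier R" "x \<ominus> y \<in> I"
  shows "x [^] k \<ominus> y [^] k \<in> I"
proof (induction k)
  case 0
  then show ?case by (simp add: minus_eq r_neg)
next
  case (Suc k)
  interpret cring R by fact
  have "x [^] Suc k \<ominus> y [^] Suc k = x \<otimes> (x [^] k \<ominus> y [^] k) \<oplus> y [^] k \<otimes> (x \<ominus> y)"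
    using assms(2,3) nat_pow_closed[OF assms(2), of k] nat_pow_closed[OF assms(3), of k]
    unfolding nat_pow_Suc by algebra
  then show ?case
    using Suc assms by (auto intro!: a_closed I_l_closed)
qed

lemma (in primeideal) power_mem:
  assumes "a \<in> carrier R" "a [^] (n::nat) \<in> I"
  shows "a \<in> I"
  using assms(2)
proof (induction n)
  case 0
  then show ?case using one_imp_carrier I_notcarr by simp
next
  case (Suc n)
  then show ?case using I_prime[of "a [^] n" a] assms(1) by auto
qed

text \<open>The polynomial ring \<open>K[X]\<close> is a retract of \<open>G\<close>, and the kernel of the retraction \<open>\<pi>\<close> is nil;
  so \<open>G\<close> and \<open>K[X]\<close> have the same primes.\<close>

locale nil_extension = poly_algebra G \<sigma> for G (structure) and \<sigma> :: "'k::field poly \<Rightarrow> 'a" +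
  fixes \<pi> :: "'a \<Rightarrow> 'k poly"
  assumes pr_hom: "\<pi> \<in> ring_hom G poly_ring"
    and pr_sec [simp]: "\<pi> (\<sigma> p) = p"
    and pr_nil: "\<lbrakk>a \<in> carrier G; \<pi> a = 0\<rbrakk> \<Longrightarrow> \<exists>n::nat. a [^] n = \<zero>"
begin

lemma pr_add [simp]: "\<lbrakk>a \<in> carrier G; b \<in> carrier G\<rbrakk> \<Longrightarrow> \<pi> (a \<oplus> b) = \<pi> a + \<pi> b"
  using ring_hom_add[OF pr_hom, of a b] by (simp add: poly_ring_def)

lemma pr_mult [simp]: "\<lbrakk>a \<in> carrier G; b \<in> carrier G\<rbrakk> \<Longrightarrow> \<pi> (a \<otimes> b) = \<pi> a * \<pi> b"
  using ring_hom_mult[OF pr_hom, of a b] by (simp add: poly_ring_def)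

lemma pr_one [simp]: "\<pi> \<one> = 1"
  using ring_hom_one[OF pr_hom] by (simp add: poly_ring_def)

lemma pr_zero [simp]: "\<pi> \<zero> = 0"
  using pr_add[of \<zero> \<zero>] by (metis add_0_right add_left_cancel r_zero zero_closed)

lemma pr_minus [simp]:
  assumes "a \<in> carrier G" "b \<in> carrier G" shows "\<pi> (a \<ominus> b) = \<pi> a - \<pi> b"
proof -
  have "(a \<ominus> b) \<oplus> b = a" using assms by algebra
  then have "\<pi> (a \<ominus> b) + \<pi> b = \<pi> a" using assms pr_add[of "a \<ominus> b" b] by simp
  then show ?thesis by (simp add: eq_diff_eq)
qed

lemma pr_a_inv [simp]: "a \<in> carrier G \<Longrightarrow> \<pi> (\<ominus> a) = - \<pi> a"
  using pr_minus[of \<zero> a] by (simp add: minus_eq)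

lemma pr_power [simp]: "a \<in> carrier G \<Longrightarrow> \<pi> (a [^] (k::nat)) = \<pi> a ^ k"
  by (induction k) (auto simp: mult.commute)

lemma one_neq_zero: "\<one> \<noteq> \<zero>"
  using pr_one pr_zero by (metis zero_neq_one)

text \<open>z - y lies in the nil kernel, say (z - y)^k = 0, and modulo J the element z agrees with
  z - y. This turns identities in K[X] into ideal membership in G, at the price of a power.\<close>

lemma power_mem_ideal:
  assumes "ideal J G" "y \<in> J" "z \<in> carrier G" "\<pi> z = \<pi> y"
  shows "\<exists>k::nat. z [^] k \<in> J"
proof -
  interpret J: ideal J G by fact
  have y: "y \<in> carrier G" using assms J.Icarr by auto
  obtain k :: nat where k: "(z \<ominus> y) [^] k = \<zero>" using pr_nil[of "z \<ominus> y"] assms y by auto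
  have "z \<ominus> (z \<ominus> y) = y" using y assms by algebra
  then have "z [^] k \<ominus> (z \<ominus> y) [^] k \<in> J"
    using J.power_minus_power[OF is_cring, of z "z \<ominus> y"] assms y by auto
  then show ?thesis using k assms by (auto simp: minus_eq)
qed

lemma ideal_eq_carrier:
  assumes "ideal J G" "y \<in> J" "\<pi> y = 1"
  shows "J = carrier G"
  using power_mem_ideal[OF assms(1,2), of \<one>] assms ideal.one_imp_carrier by auto

lemma prime_contains_nil:
  assumes "primeideal Q G" "a \<in> carrier G" "\<pi> a = 0"
  shows "a \<in> Q"
proof -
  interpret primeideal Q G by fact
  show ?thesis using pr_nil[OF assms(2,3)] power_mem[OF assms(2)] zero_closed by metis
qed

text \<open>a - \<sigma>(\<pi> a) is nilpotent, hence in every prime; a prime of G is thus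
  determined by the polynomials it contains.\<close>

lemma prime_sec_pr:
  assumes "primeideal Q G" "a \<in> carrier G"
  shows "\<sigma> (\<pi> a) \<in> Q \<longleftrightarrow> a \<in> Q"
proof -
  interpret primeideal Q G by fact
  have d: "a \<ominus> \<sigma> (\<pi> a) \<in> Q" using prime_contains_nil[OF assms(1)] assms by simp
  have "a = (a \<ominus> \<sigma> (\<pi> a)) \<oplus> \<sigma> (\<pi> a)" "\<sigma> (\<pi> a) = a \<oplus> (\<ominus> (a \<ominus> \<sigma> (\<pi> a)))"
    using assms sec_closed[of "\<pi> a"] by algebra+
  then show ?thesis using d a_closed a_inv_closed by metis
qed

text \<open>d = 0 gives the nil kernel, the smallest prime; d = X gives the maximal ideal at the
  origin.\<close>

lemma ideal_dvd: "ideal {a \<in> carrier G. d dvd \<pi> a} G"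
proof (rule idealI[OF ring_axioms])
  show "subgroup {a \<in> carrier G. d dvd \<pi> a} (add_monoid G)"
    by (rule add.subgroupI) (auto simp flip: a_inv_def)
qed auto

section \<open>Depth, height and the Cohen-Macaulay property of a nil extension\<close>

lemma genideal_empty: "Idl {} = {\<zero>}"
proof
  show "Idl {} \<subseteq> {\<zero>}" using genideal_minimal[OF zeroideal] by blast
  interpret ideal "Idl {}" G by (rule genideal_ideal) simp
  show "{\<zero>} \<subseteq> Idl {}" using zero_closed by blast
qed

text \<open>For the first two members x, y let f be the part of \<pi> x coprime to \<pi> y. Some
  power of f y^e lies in (x); y is regular modulo x and can be cancelled, so a power of f lies in
  (x). But this power is coprime to \<pi> y, so the whole sequence generates an element with image
  1, hence everything.\<close>

lemma regular_seq_length: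
  assumes xs: "regular_seq G xs"
  shows "length xs \<le> 1"
proof (rule ccontr)
  assume "\<not> length xs \<le> 1"
  then have len: "1 < length xs" by simp
  define x y where "x = xs ! 0" and "y = xs ! 1"
  have sub: "set xs \<subseteq> carrier G" and proper: "Idl (set xs) \<noteq> carrier G"
    and reg: "\<And>i a. i < length xs \<Longrightarrow> a \<in> carrier G \<Longrightarrow> xs ! i \<otimes> a \<in> Idl (set (take i xs))
       \<Longrightarrow> a \<in> Idl (set (take i xs))"
    using xs unfolding regular_seq_def by auto
  have xy: "x \<in> set xs" "y \<in> set xs" using len by (auto simp: x_def y_def intro!: nth_mem)
  with sub have c: "x \<in> carrier G" "y \<in> carrier G" by auto
  have len0: "0 < length xs" using len by linarith
  have "a = \<zero>" if "a \<in> carrier G" "x \<otimes> a = \<zero>" for a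
    using reg[OF len0 that(1)] that(2) unfolding x_def by (simp add: genideal_empty)
  then have "nzd G x" unfolding nzd_def by blast
  have "take 1 xs = [x]" using len by (cases xs) (auto simp: x_def)
  then have y_reg: "a \<in> PIdl x" if "a \<in> carrier G" "y \<otimes> a \<in> PIdl x" for a
    using reg[of 1 a] len that c unfolding y_def by (simp add: cgenideal_eq_genideal)
  interpret J: ideal "PIdl x" G by (rule cgenideal_ideal) fact
  interpret I: ideal "Idl (set xs)" G by (rule genideal_ideal) fact
  have "\<pi> x \<noteq> 0"
  proof
    assume "\<pi> x = 0"
    then obtain n :: nat where "x [^] n = \<zero>" using pr_nil c by auto
    then show False using nzd_power[OF c(1) \<open>nzd G x\<close>, of n] one_neq_zero
      unfolding nzd_def by (metis l_null one_closed)
  qed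
  then obtain f e q u v where f: "f * \<pi> y ^ e = \<pi> x * q" "u * f + v * \<pi> y = 1"
    by (rule poly_coprime_part)
  have "\<sigma> q \<otimes> x \<in> PIdl x" using sec_closed[of q] unfolding cgenideal_def by blast
  then obtain k :: nat where "(\<sigma> f \<otimes> y [^] e) [^] k \<in> PIdl x"
    using power_mem_ideal[OF J.is_ideal, of "\<sigma> q \<otimes> x" "\<sigma> f \<otimes> y [^] e"] c f(1)
    by (simp add: mult.commute) blast
  then have "y [^] (e * k) \<otimes> \<sigma> (f ^ k) \<in> PIdl x"
    using c by (simp add: nat_pow_distrib nat_pow_pow sec_power m_comm)
  moreover have "a \<in> PIdl x" if "a \<in> carrier G" "y [^] (m::nat) \<otimes> a \<in> PIdl x" for a m
    using that
  proof (induction m arbitrary: a)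
    case (Suc m)
    have "y [^] m \<otimes> (y \<otimes> a) \<in> PIdl x"
      using Suc.prems c nat_pow_closed[OF c(2), of m] by (simp add: m_assoc)
    then show ?case using Suc.IH[OF m_closed[OF c(2) Suc.prems(1)]] y_reg[OF Suc.prems(1)] by blast
  qed simp
  ultimately have "\<sigma> (f ^ k) \<in> PIdl x" by simp
  then obtain b where b: "b \<in> carrier G" "\<sigma> (f ^ k) = b \<otimes> x" unfolding cgenideal_def by blast
  obtain w where w: "u ^ k * f ^ k + w * \<pi> y = 1" using poly_bezout_power[OF f(2)] .
  have "\<sigma> (u ^ k) \<otimes> \<sigma> (f ^ k) \<oplus> \<sigma> w \<otimes> y \<in> Idl (set xs)"
    unfolding b(2) using genideal_self[OF sub] xy b(1)
    by (intro I.a_closed I.I_l_closed) auto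
  moreover have "\<pi> (\<sigma> (u ^ k) \<otimes> \<sigma> (f ^ k) \<oplus> \<sigma> w \<otimes> y) = 1" using w c by simp
  ultimately show False using ideal_eq_carrier[OF I.is_ideal] proper by blast
qed

text \<open>Take a in Q1 outside Q0, so that \<pi> a is nonzero, and b in Q2 outside Q1. For the
  part f of \<pi> a coprime to \<pi> b, some f (\<pi> b)^e lies in Q1, hence so does f; then Q2
  contains both f and \<pi> b, which generate 1.\<close>

lemma no_prime_chain:
  assumes Q: "primeideal Q0 G" "primeideal Q1 G" "primeideal Q2 G" and "Q0 \<subset> Q1"
  shows "\<not> Q1 \<subset> Q2"
proof
  assume "Q1 \<subset> Q2"
  interpret Q1: primeideal Q1 G by fact
  interpret Q2: primeideal Q2 G by fact
  obtain a where a: "a \<in> Q1" "a \<notin> Q0" using assms by auto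
  obtain b where b: "b \<in> Q2" "b \<notin> Q1" using \<open>Q1 \<subset> Q2\<close> by auto
  have c: "a \<in> carrier G" "b \<in> carrier G" using a b Q1.Icarr Q2.Icarr by auto
  have "\<pi> a \<noteq> 0" using prime_contains_nil[OF Q(1)] a c by auto
  then obtain f e q u v where f: "f * \<pi> b ^ e = \<pi> a * q" "u * f + v * \<pi> b = 1"
    by (rule poly_coprime_part)
  have sa: "\<sigma> (\<pi> a) \<in> Q1" and sb: "\<sigma> (\<pi> b) \<in> Q2" "\<sigma> (\<pi> b) \<notin> Q1"
    using prime_sec_pr Q a b c by auto
  have "\<sigma> f \<otimes> \<sigma> (\<pi> b) [^] e \<in> Q1"
    using Q1.I_r_closed[OF sa, of "\<sigma> q"] by (simp flip: sec_mult sec_power f(1))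
  then have "\<sigma> f \<in> Q1"
    using Q1.I_prime[of "\<sigma> f" "\<sigma> (\<pi> b) [^] e"] Q1.power_mem[OF sec_closed] sb(2)
      nat_pow_closed[OF sec_closed] sec_closed by blast
  then have "\<sigma> f \<in> Q2" using \<open>Q1 \<subset> Q2\<close> by auto
  then have "\<sigma> u \<otimes> \<sigma> f \<oplus> \<sigma> v \<otimes> \<sigma> (\<pi> b) \<in> Q2"
    using sb by (intro Q2.a_closed Q2.I_l_closed) auto
  then have "\<one> \<in> Q2" by (simp flip: sec_mult sec_add add: f(2))
  then show False using Q2.one_imp_carrier Q2.I_notcarr by simp
qed

lemma nil_prime: "primeideal {a \<in> carrier G. 0 dvd \<pi> a} G"
proof (rule primeidealI[OF ideal_dvd is_cring])
  have "\<one> \<notin> {a \<in> carrier G. 0 dvd \<pi> a}" by simp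
  then show "carrier G \<noteq> {a \<in> carrier G. 0 dvd \<pi> a}" using one_closed by blast
qed auto

lemma origin_maximal: "maximalideal {a \<in> carrier G. [:0, 1:] dvd \<pi> a} G" (is "maximalideal ?M G")
proof (rule maximalidealI[OF ideal_dvd])
  have iff: "[:0, 1:] dvd p \<longleftrightarrow> poly p 0 = 0" for p :: "'k poly"
    using poly_eq_0_iff_dvd[of p 0] by simp
  have "\<one> \<notin> ?M" using iff[of 1] by simp
  then show "carrier G \<noteq> ?M" using one_closed by blast
  fix J assume J: "ideal J G" "?M \<subseteq> J" "J \<subseteq> carrier G"
  show "J = ?M \<or> J = carrier G"
  proof (cases "J = ?M")
    case False
    then obtain a where a: "a \<in> J" "\<not> [:0, 1:] dvd \<pi> a" "a \<in> carrier G" using J by blast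
    interpret J: ideal J G by fact
    \<comment> \<open>\<pi> a has nonzero constant term, as X does not divide it. Scaling makes the
      constant term of r equal to 1, so 1 - r vanishes at 0 and its image already lies in J.\<close>
    define r where "r = [:1 / poly (\<pi> a) 0:] * \<pi> a"
    have "\<sigma> (1 - r) \<in> J" using J(2) a by (auto simp: iff r_def)
    then have "\<sigma> (1 - r) \<oplus> \<sigma> [:1 / poly (\<pi> a) 0:] \<otimes> a \<in> J"
      using a by (intro J.a_closed J.I_l_closed) auto
    moreover have "\<pi> (\<sigma> (1 - r) \<oplus> \<sigma> [:1 / poly (\<pi> a) 0:] \<otimes> a) = 1"
      using a by (simp add: r_def)
    ultimately show ?thesis using ideal_eq_carrier[OF J(1)] by blast
  qed simp
qed

lemma maximal_not_nil:
  assumes "maximalideal P G"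
  obtains a where "a \<in> P" "\<pi> a \<noteq> 0"
proof -
  interpret P: maximalideal P G by fact
  note M = origin_maximal
  have "\<exists>a\<in>P. \<pi> a \<noteq> 0"
  proof (rule ccontr)
    assume "\<not> ?thesis"
    then have P0: "\<pi> a = 0" if "a \<in> P" for a using that by blast
    have "P \<subseteq> {a \<in> carrier G. [:0, 1:] dvd \<pi> a}"
    proof
      fix a assume "a \<in> P"
      then show "a \<in> {a \<in> carrier G. [:0, 1:] dvd \<pi> a}" using P0[of a] P.Icarr[of a] by simp
    qed
    then have "{a \<in> carrier G. [:0, 1:] dvd \<pi> a} = P"
      using P.I_maximal[OF ideal_dvd] maximalideal.I_notcarr[OF M] by auto
    moreover have "\<sigma> [:0, 1:] \<in> {a \<in> carrier G. [:0, 1:] dvd \<pi> a}" by simp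
    ultimately have "\<pi> (\<sigma> [:0, 1:]) = 0" using P0 by blast
    then show False by simp
  qed
  with that show ?thesis by blast
qed

lemma prime_height_maximal:
  assumes P: "maximalideal P G"
  shows "prime_height G P = 1"
proof -
  let ?A = "{enat n | n ps. length ps = n + 1 \<and> sorted_wrt (\<subset>) ps \<and>
                             (\<forall>Q\<in>set ps. primeideal Q G) \<and> last ps = P}"
  have Pp: "primeideal P G" using maximalideal_prime[OF P] .
  let ?N = "{a \<in> carrier G. 0 dvd \<pi> a}"
  have "?N \<subseteq> P" using prime_contains_nil[OF Pp] by auto
  moreover obtain a where "a \<in> P" "\<pi> a \<noteq> 0" by (rule maximal_not_nil[OF P])
  then have "?N \<noteq> P" by auto
  ultimately have "enat 1 \<in> ?A"
    using Pp nil_prime by (intro CollectI exI[of _ 1] exI[of _ "[?N, P]"]) auto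
  then have "1 \<le> Sup ?A" by (intro Sup_upper) (simp add: one_enat_def)
  moreover have "Sup ?A \<le> 1"
  proof (rule Sup_least)
    fix z assume "z \<in> ?A"
    then obtain n ps where z: "z = enat n" "length ps = n + 1" "sorted_wrt (\<subset>) ps"
      "\<forall>Q\<in>set ps. primeideal Q G" by auto
    have "n \<le> 1"
    proof (rule ccontr)
      assume "\<not> n \<le> 1"
      then have l: "2 < length ps" using z by simp
      then have "ps ! 0 \<subset> ps ! 1" "ps ! 1 \<subset> ps ! 2"
        using z(3) by (auto simp: sorted_wrt_iff_nth_less)
      moreover have "primeideal (ps ! 0) G" "primeideal (ps ! 1) G" "primeideal (ps ! 2) G"
        using z(4) l by (auto intro!: bspec[OF z(4)] nth_mem)
      ultimately show False using no_prime_chain by blast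
    qed
    then show "z \<le> 1" using z(1) by (simp add: one_enat_def)
  qed
  ultimately show ?thesis unfolding prime_height_def by (rule antisym[rotated])
qed

text \<open>Regular sequences have length at most 1, so the depth is 0 or 1 and only one-element
  sequences matter; inside a proper ideal these generate a proper ideal automatically.\<close>

lemma ideal_depth_eq_one_iff:
  assumes P: "ideal P G" "P \<noteq> carrier G"
  shows "ideal_depth G P = 1 \<longleftrightarrow> (\<exists>x\<in>P. nzd G x)"
proof -
  interpret P: ideal P G by fact
  let ?A = "{enat (length xs) | xs. regular_seq G xs \<and> set xs \<subseteq> P}"
  have single: "regular_seq G [x] \<longleftrightarrow> nzd G x" if "x \<in> P" for x
  proof -
    have "Idl {x} \<subseteq> P" using genideal_minimal[OF P(1)] that by simp
    then have "Idl {x} \<noteq> carrier G" using P P.a_subset by auto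
    then show ?thesis using P.Icarr[OF that] by (auto simp: regular_seq_def nzd_def genideal_empty)
  qed
  have le: "Sup ?A \<le> 1"
    by (rule Sup_least) (use regular_seq_length in \<open>auto simp: one_enat_def\<close>)
  show ?thesis
  proof
    assume "\<exists>x\<in>P. nzd G x"
    then obtain x where "x \<in> P" "nzd G x" by blast
    then have "enat 1 \<in> ?A" using single by (intro CollectI exI[of _ "[x]"]) auto
    then have "1 \<le> Sup ?A" by (intro Sup_upper) (simp add: one_enat_def)
    with le show "ideal_depth G P = 1" unfolding ideal_depth_def by (rule antisym)
  next
    assume d: "ideal_depth G P = 1"
    show "\<exists>x\<in>P. nzd G x"
    proof (rule ccontr)
      assume no: "\<not> ?thesis"
      have "Sup ?A \<le> 0"
      proof (rule Sup_least)
        fix z assume "z \<in> ?A"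
        then obtain xs where xs: "z = enat (length xs)" "regular_seq G xs" "set xs \<subseteq> P" by blast
        have "xs = []"
        proof (cases xs)
          case (Cons x ys)
          then have "xs = [x]" using regular_seq_length[OF xs(2)] by auto
          then show ?thesis using xs single no by auto
        qed simp
        then show "z \<le> 0" using xs by (simp add: zero_enat_def)
      qed
      then show False using d unfolding ideal_depth_def by simp
    qed
  qed
qed

text \<open>\<open>graded\<close> is a genuine hypothesis: in K[X][e] / (e^2, (X - 1) e) the element
  X is a nonzerodivisor but X - 1 is not. For the tangent cone it comes from the grading, by
  comparing lowest terms.\<close>

theorem cohen_macaulay_iff_nzd:
  assumes "noetherian_ring G"
    and graded: "\<And>p. nzd G (\<sigma> [:0, 1:]) \<Longrightarrow> p \<noteq> 0 \<Longrightarrow> nzd G (\<sigma> p)"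
  shows "cohen_macaulay G \<longleftrightarrow> nzd G (\<sigma> [:0, 1:])"
proof
  assume CM: "cohen_macaulay G"
  let ?M = "{a \<in> carrier G. [:0, 1:] dvd \<pi> a}"
  note M = origin_maximal
  have "ideal_depth G ?M = 1"
    using CM origin_maximal prime_height_maximal[OF origin_maximal] unfolding cohen_macaulay_def by auto
  then obtain x where x: "x \<in> carrier G" "[:0, 1:] dvd \<pi> x" "nzd G x"
    using ideal_depth_eq_one_iff[OF ideal_dvd] maximalideal.I_notcarr[OF M] by auto
  then obtain q where q: "\<pi> x = q * [:0, 1:]" by (metis dvdE mult.commute)
  have "\<sigma> q \<otimes> \<sigma> [:0, 1:] \<in> PIdl (\<sigma> [:0, 1:])"
    using sec_closed[of q] unfolding cgenideal_def by blast
  then obtain k :: nat where "x [^] k \<in> PIdl (\<sigma> [:0, 1:])"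
    using power_mem_ideal[OF cgenideal_ideal[OF sec_closed], of _ _ x] x q
    by (metis pr_mult pr_sec sec_closed)
  then obtain b where b: "b \<in> carrier G" "x [^] k = b \<otimes> \<sigma> [:0, 1:]" unfolding cgenideal_def by blast
  show "nzd G (\<sigma> [:0, 1:])"
    unfolding nzd_def
  proof (intro ballI impI)
    fix a assume a: "a \<in> carrier G" "\<sigma> [:0, 1:] \<otimes> a = \<zero>"
    then have "x [^] k \<otimes> a = \<zero>" using b by (simp add: m_assoc)
    then show "a = \<zero>" using nzd_power[OF x(1,3), of k] a unfolding nzd_def by blast
  qed
next
  assume T: "nzd G (\<sigma> [:0, 1:])"
  have "ideal_depth G P = prime_height G P" if P: "maximalideal P G" for P
  proof -
    interpret P: maximalideal P G by fact
    \<comment> \<open>A maximal ideal away from the origin need not contain T, but it contains some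
      nonzero polynomial, which \<open>graded\<close> makes a nonzerodivisor.\<close>
    obtain a where a: "a \<in> P" "\<pi> a \<noteq> 0" by (rule maximal_not_nil[OF P])
    then have "\<sigma> (\<pi> a) \<in> P" using prime_sec_pr[OF maximalideal_prime[OF P]] P.Icarr by blast
    moreover have "nzd G (\<sigma> (\<pi> a))" using graded[OF T a(2)] .
    ultimately have "ideal_depth G P = 1"
      using ideal_depth_eq_one_iff[OF P.is_ideal] P.I_notcarr by blast
    then show ?thesis using prime_height_maximal[OF P] by simp
  qed
  then show "cohen_macaulay G" unfolding cohen_macaulay_def using assms(1) is_cring by blast
qed

end

section \<open>Numerical semigroups\<close>

lemma semigroup_span_add:
  assumes "s \<in> semigroup_span A" "t \<in> semigroup_span A"
  shows "s + t \<in> semigroup_span A"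
  using assms by induction (auto simp: add.assoc intro: semigroup_span.add)

lemma semigroup_span_gen: "a \<in> A \<Longrightarrow> a \<in> semigroup_span A"
  using semigroup_span.add[of a A 0] by (simp add: semigroup_span.zero)

lemma semigroup_span_mult: "s \<in> semigroup_span A \<Longrightarrow> k * s \<in> semigroup_span A"
  by (induction k) (auto intro: semigroup_span.zero semigroup_span_add)

lemma semigroup_span_sum_list: "set xs \<subseteq> semigroup_span A \<Longrightarrow> sum_list xs \<in> semigroup_span A"
  by (induction xs) (auto intro: semigroup_span.zero semigroup_span_add)

lemma semigroup_span_listE:
  assumes "s \<in> semigroup_span A"
  obtains xs where "set xs \<subseteq> A" "sum_list xs = s"
proof -
  have "\<exists>xs. set xs \<subseteq> A \<and> sum_list xs = s"
    using assms
  proof induction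
    case zero
    show ?case by (rule exI[of _ "[]"]) simp
  next
    case (add a s)
    then obtain xs where "set xs \<subseteq> A" "sum_list xs = s" by blast
    with add show ?case by (intro exI[of _ "a # xs"]) simp
  qed
  with that show ?thesis by blast
qed

text \<open>The least positive difference d of two elements of the span divides each generator a:
  with q = a div d, the elements q (b + d) and a + q b differ by a mod d, so a nonzero remainder
  would be a smaller difference. Hence d divides the gcd.\<close>

lemma semigroup_span_consecutive:
  assumes "Gcd A = 1"
  obtains b where "b \<in> semigroup_span A" "b + 1 \<in> semigroup_span A"
proof -
  let ?S = "semigroup_span A"
  define P where "P d \<longleftrightarrow> 0 < d \<and> (\<exists>b\<in>?S. b + d \<in> ?S)" for d
  obtain g where g: "g \<in> A" "g \<noteq> 0"
    using assms by (metis Gcd_0_iff subset_singleton_iff subsetI singletonI insertCI zero_neq_one)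
  then have "P g" unfolding P_def
    by (auto intro!: bexI[of _ 0] semigroup_span_gen semigroup_span.zero)
  define d where "d = (LEAST d. P d)"
  have d: "P d" unfolding d_def using \<open>P g\<close> by (rule LeastI)
  then obtain b where b: "b \<in> ?S" "b + d \<in> ?S" and "0 < d" unfolding P_def by blast
  have "d dvd a" if "a \<in> A" for a
  proof (rule ccontr)
    assume "\<not> d dvd a"
    then have pos: "0 < a mod d" by (simp add: mod_greater_zero_iff_not_dvd)
    have "a div d * (b + d) + a mod d = a + a div d * b"
      by (simp add: algebra_simps)
    moreover have "a + a div d * b \<in> ?S"
      by (rule semigroup_span_add[OF semigroup_span_gen[OF that] semigroup_span_mult[OF b(1)]])
    ultimately have "P (a mod d)" unfolding P_def
      using pos b by (intro conjI bexI[of _ "a div d * (b + d)"] semigroup_span_mult) auto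
    then have "d \<le> a mod d" unfolding d_def by (rule Least_le)
    then show False using mod_less_divisor[OF \<open>0 < d\<close>, of a] by linarith
  qed
  then have "d dvd Gcd A" by (rule Gcd_greatest)
  then have "d = 1" using assms by simp
  with b that show ?thesis by simp
qed

lemma sum_list_count_filter:
  fixes xs :: "nat list"
  shows "sum_list xs = count_list xs g * g + sum_list (filter (\<lambda>x. x \<noteq> g) xs)"
    and "length xs = count_list xs g + length (filter (\<lambda>x. x \<noteq> g) xs)"
  by (induction xs) auto

lemma apery_props:
  assumes "s \<in> S" "s mod m = i mod m"
  shows "apery S m i \<in> S" "apery S m i mod m = i mod m" "apery S m i \<le> s"
proof -
  have "apery S m i \<in> S \<and> apery S m i mod m = i mod m"
    unfolding apery_def by (rule LeastI[of "\<lambda>s. s \<in> S \<and> s mod m = i mod m" s]) (simp add: assms)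
  then show "apery S m i \<in> S" "apery S m i mod m = i mod m" by auto
  show "apery S m i \<le> s"
    unfolding apery_def by (rule Least_le) (simp add: assms)
qed

locale numerical_semigroup =
  fixes gs :: "nat list" and S :: "nat set" and m :: nat
  assumes sorted: "sorted_wrt (<) gs"
    and Gcd_gs: "Gcd (set gs) = 1"
    and minimal: "\<forall>g\<in>set gs. g \<notin> semigroup_span (set gs - {g})"
    and S_def: "S = semigroup_span (set gs)"
    and m_def: "m = hd gs"
begin

lemma gs_Cons: "gs = m # tl gs"
  using Gcd_gs by (cases gs) (auto simp: m_def)

lemma m_gen: "m \<in> set gs"
  using gs_Cons by (metis list.set_intros(1))

text \<open>Minimality excludes 0 as a generator, since 0 lies in every span.\<close>

lemma gen_pos: "g \<in> set gs \<Longrightarrow> 0 < g"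
  using minimal semigroup_span.zero by (metis neq0_conv)

lemma m_pos [simp]: "0 < m"
  using gen_pos m_gen by blast

lemma m_nonzero [simp]: "m \<noteq> 0"
  using m_pos by simp

lemma tl_gt: "g \<in> set (tl gs) \<Longrightarrow> m < g"
  using sorted gs_Cons by (metis sorted_wrt.simps(2))

lemma gen_cases: "g \<in> set gs \<longleftrightarrow> g = m \<or> g \<in> set (tl gs)"
  using gs_Cons by (metis set_ConsD list.set_intros)

lemma gen_ge: "g \<in> set gs \<Longrightarrow> m \<le> g"
  using gen_cases tl_gt by fastforce

lemma S_zero [simp]: "0 \<in> S"
  by (simp add: S_def semigroup_span.zero)

lemma S_add [simp]: "s \<in> S \<Longrightarrow> t \<in> S \<Longrightarrow> s + t \<in> S"
  by (simp add: S_def semigroup_span_add)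

lemma S_gen: "g \<in> set gs \<Longrightarrow> g \<in> S"
  by (simp add: S_def semigroup_span_gen)

lemma S_mult_m [simp]: "k * m \<in> S"
  unfolding S_def by (intro semigroup_span_mult semigroup_span_gen m_gen)

text \<open>i copies of b + 1 and i (m - 1) copies of b add up to i + m (i b). So every residue
  class meets S, and the LEAST in \<open>apery\<close> is attained.\<close>

lemma S_residue: "\<exists>s\<in>S. s mod m = i mod m"
proof -
  obtain b where b: "b \<in> S" "b + 1 \<in> S"
    using semigroup_span_consecutive[OF Gcd_gs] unfolding S_def .
  have "i * (b + 1) + (i * (m - 1)) * b \<in> S"
    by (intro S_add; unfold S_def; intro semigroup_span_mult) (use b S_def in auto)
  moreover have "i * (b + 1) + (i * (m - 1)) * b = i + m * (i * b)"
    using m_pos by (cases m) (auto simp: algebra_simps)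
  ultimately show ?thesis by (metis mod_mult_self2)
qed

section \<open>Lengths of factorisations and the order function\<close>

lemma sum_list_ge: "set xs \<subseteq> set gs \<Longrightarrow> length xs * m \<le> sum_list xs"
  by (induction xs) (auto simp: gen_ge add_mono)

lemma S_nonzero_list:
  assumes "set xs \<subseteq> S - {0}"
  shows "\<exists>ys. set ys \<subseteq> set gs \<and> sum_list ys = sum_list xs \<and> length xs \<le> length ys"
  using assms
proof (induction xs)
  case (Cons x xs)
  then obtain ys where ys: "set ys \<subseteq> set gs" "sum_list ys = sum_list xs" "length xs \<le> length ys"
    by fastforce
  have "x \<in> semigroup_span (set gs)" using Cons S_def by auto
  then obtain zs where zs: "set zs \<subseteq> set gs" "sum_list zs = x" by (rule semigroup_span_listE)
  have "zs \<noteq> []" using zs(2) Cons.prems by auto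
  then have "1 \<le> length zs" by (cases zs) auto
  then show ?case using ys zs by (intro exI[of _ "zs @ ys"]) auto
next
  case Nil
  show ?case by (rule exI[of _ "[]"]) simp
qed

lemma mult_M_iff:
  "s \<in> mult_M S h \<longleftrightarrow> (\<exists>xs. set xs \<subseteq> set gs \<and> sum_list xs = s \<and> h \<le> length xs)"
proof (cases "h = 0")
  case True
  have "sum_list xs \<in> S" if "set xs \<subseteq> set gs" for xs
    unfolding S_def by (rule semigroup_span_sum_list) (use that semigroup_span_gen in auto)
  moreover have "\<exists>xs. set xs \<subseteq> set gs \<and> sum_list xs = s" if "s \<in> S"
    using that semigroup_span_listE unfolding S_def by blast
  ultimately show ?thesis using True by (auto simp: mult_M_def)
next
  case False
  show ?thesis
  proof
    assume "s \<in> mult_M S h"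
    then obtain xs where "length xs = h" "set xs \<subseteq> S - {0}" "s = sum_list xs"
      using False by (auto simp: mult_M_def)
    then show "\<exists>xs. set xs \<subseteq> set gs \<and> sum_list xs = s \<and> h \<le> length xs"
      using S_nonzero_list[of xs] by auto
  next
    assume "\<exists>xs. set xs \<subseteq> set gs \<and> sum_list xs = s \<and> h \<le> length xs"
    then obtain xs where xs: "set xs \<subseteq> set gs" "sum_list xs = s" "h \<le> length xs" by blast
    define us vs where "us = take (h - 1) xs" and "vs = drop (h - 1) xs"
    have uv: "xs = us @ vs" by (simp add: us_def vs_def)
    have vs: "1 \<le> length vs" using xs(3) False by (simp add: vs_def)
    have sub: "set us \<subseteq> set gs" "set vs \<subseteq> set gs" using xs(1) uv by auto
    have "0 < length vs * m" using vs m_pos by (metis One_nat_def Suc_le_eq nat_0_less_mult_iff)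
    then have "0 < sum_list vs" using sum_list_ge[OF sub(2)] by linarith
    moreover have "sum_list vs \<in> S"
      unfolding S_def by (rule semigroup_span_sum_list) (use sub semigroup_span_gen in auto)
    moreover have "set us \<subseteq> S - {0}" using sub S_gen gen_pos by fastforce
    moreover have "length us = h - 1" using xs(3) by (simp add: us_def)
    ultimately show "s \<in> mult_M S h"
      using False xs(2) unfolding mult_M_def uv
      by (simp del: sum_list_eq_0_iff) (intro exI[of _ "us @ [sum_list vs]"], auto simp del: sum_list_eq_0_iff)
  qed
qed

lemma mult_M_mono: "s \<in> mult_M S h \<Longrightarrow> h' \<le> h \<Longrightarrow> s \<in> mult_M S h'"
  unfolding mult_M_iff using le_trans by blast

lemma mult_M_subset: "s \<in> mult_M S h \<Longrightarrow> s \<in> S"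
  using mult_M_mono[of s h 0] by (simp add: mult_M_def)

lemma mult_M_add:
  assumes "s \<in> mult_M S h" "t \<in> mult_M S k"
  shows "s + t \<in> mult_M S (h + k)"
proof -
  obtain xs ys where "set xs \<subseteq> set gs" "sum_list xs = s" "h \<le> length xs"
    "set ys \<subseteq> set gs" "sum_list ys = t" "k \<le> length ys"
    using assms unfolding mult_M_iff by blast
  then show ?thesis unfolding mult_M_iff by (intro exI[of _ "xs @ ys"]) auto
qed

lemma mult_M_bound: "s \<in> mult_M S h \<Longrightarrow> h * m \<le> s"
  unfolding mult_M_iff using sum_list_ge by (meson le_trans mult_le_mono1)

text \<open>The sets hM decrease with h, and s in hM forces h m <= s, so a greatest h exists; it is
  the unique value described by the THE in \<open>ord_M\<close>.\<close>

lemma mult_M_iff_ord: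
  assumes "s \<in> S"
  shows "s \<in> mult_M S h \<longleftrightarrow> h \<le> ord_M S s"
proof -
  define P where "P h \<longleftrightarrow> s \<in> mult_M S h" for h
  have P0: "P 0" using assms by (simp add: P_def mult_M_def)
  have bound: "h \<le> s" if "P h" for h
  proof -
    have "h * 1 \<le> h * m" by (intro mult_le_mono) (use m_pos in linarith)+
    with mult_M_bound[of s h] that show ?thesis unfolding P_def by linarith
  qed
  define k where "k = (GREATEST h. P h)"
  have Pk: "P k" unfolding k_def using P0 bound by (rule GreatestI_nat)
  have kmax: "h \<le> k" if "P h" for h unfolding k_def using that bound by (rule Greatest_le_nat)
  have "ord_M S s = k"
    unfolding ord_M_def
  proof (rule the_equality)
    show "s \<in> mult_M S k \<and> s \<notin> mult_M S (k + 1)"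
      using Pk kmax[of "k + 1"] unfolding P_def by auto
    fix h assume h: "s \<in> mult_M S h \<and> s \<notin> mult_M S (h + 1)"
    show "h = k"
    proof (rule ccontr)
      assume "h \<noteq> k"
      with kmax[of h] h have "h + 1 \<le> k" unfolding P_def by auto
      with Pk h mult_M_mono show False unfolding P_def by blast
    qed
  qed
  then show ?thesis using Pk kmax mult_M_mono unfolding P_def by blast
qed

abbreviation ord :: "nat \<Rightarrow> nat" where "ord s \<equiv> ord_M S s"

lemma ord_leI: "s \<in> mult_M S h \<Longrightarrow> h \<le> ord s"
  using mult_M_iff_ord mult_M_subset by blast

lemma mult_M_ord: "s \<in> S \<Longrightarrow> s \<in> mult_M S (ord s)"
  by (simp add: mult_M_iff_ord)

lemma ord_add_ge: "s \<in> S \<Longrightarrow> t \<in> S \<Longrightarrow> ord s + ord t \<le> ord (s + t)"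
  by (intro ord_leI mult_M_add mult_M_ord)

lemma ord_bound: "s \<in> S \<Longrightarrow> ord s * m \<le> s"
  by (intro mult_M_bound mult_M_ord)

lemma ord_mult_m [simp]: "ord (k * m) = k"
proof (rule antisym)
  show "ord (k * m) \<le> k" using ord_bound[of "k * m"] by simp
  have "k * m \<in> mult_M S k" unfolding mult_M_iff
    using m_gen by (intro exI[of _ "replicate k m"]) (auto simp: sum_list_replicate)
  then show "k \<le> ord (k * m)" by (rule ord_leI)
qed

lemma ord_zero [simp]: "ord 0 = 0"
  using ord_mult_m[of 0] by simp

lemma ord_listE:
  assumes "s \<in> S"
  obtains xs where "set xs \<subseteq> set gs" "sum_list xs = s" "length xs = ord s"
proof -
  obtain xs where xs: "set xs \<subseteq> set gs" "sum_list xs = s" "ord s \<le> length xs"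
    using mult_M_ord[OF assms] unfolding mult_M_iff by blast
  then have "s \<in> mult_M S (length xs)" unfolding mult_M_iff by blast
  then have "length xs \<le> ord s" by (rule ord_leI)
  with xs that show ?thesis by auto
qed

text \<open>In a factorisation of maximal length a generator \<open>g > m\<close> occurs fewer than \<open>m\<close> times,
  since \<open>m\<close> copies of \<open>g\<close> could be traded for \<open>g\<close> copies of \<open>m\<close>.\<close>

lemma ord_decomposition:
  "\<exists>N. \<forall>s\<in>S. \<exists>w k. w \<in> S \<and> w \<le> N \<and> s = w + k * m \<and> ord s = ord w + k"
proof (rule exI[of _ "\<Sum>g\<in>set gs. m * g"], rule ballI)
  fix s assume "s \<in> S"
  then obtain xs where xs: "set xs \<subseteq> set gs" "sum_list xs = s" "length xs = ord s"
    by (rule ord_listE)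
  define ys w k where "ys = filter (\<lambda>x. x \<noteq> m) xs" and "w = sum_list ys" and "k = count_list xs m"
  have ys: "set ys \<subseteq> set gs" using xs by (auto simp: ys_def)
  have s: "s = w + k * m" "ord s = length ys + k"
    using sum_list_count_filter[of xs m] xs by (auto simp: ys_def w_def k_def)
  have wM: "w \<in> mult_M S (length ys)" unfolding mult_M_iff w_def using ys by blast
  have wS: "w \<in> S" using mult_M_subset[OF wM] .
  have ordw: "ord w = length ys"
    using ord_leI[OF wM] ord_add_ge[OF wS S_mult_m[of k]] s by simp
  have count: "count_list ys g \<le> m" if g: "g \<in> set ys" for g
  proof (rule ccontr)
    assume c: "\<not> count_list ys g \<le> m"
    define c where "c = count_list ys g"
    have g': "g \<in> set gs" "g \<noteq> m" using g xs by (auto simp: ys_def)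
    have gm: "m < g" using gen_ge[OF g'(1)] g'(2) by simp
    \<comment> \<open>m copies of g become g copies of m: the sum is unchanged and the list is
      longer because m < g.\<close>
    let ?zs = "replicate g m @ replicate (c - m) g @ filter (\<lambda>x. x \<noteq> g) ys"
    have cm: "m < c" using c by (simp add: c_def)
    then obtain d where d: "c = m + d" using less_imp_add_positive by blast
    have "sum_list ?zs = w"
      using sum_list_count_filter(1)[of ys g] unfolding w_def c_def[symmetric]
      by (simp add: sum_list_replicate d algebra_simps)
    moreover have "set ?zs \<subseteq> set gs" using ys g' m_gen by auto
    ultimately have "w \<in> mult_M S (length ?zs)" unfolding mult_M_iff by blast
    then have "length ?zs \<le> ord w" by (rule ord_leI)
    moreover have "length ys < length ?zs"
      using sum_list_count_filter(2)[of ys g] gm cm unfolding c_def[symmetric] by simp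
    ultimately show False using ordw by simp
  qed
  have "w = (\<Sum>g\<in>set ys. count_list ys g * g)"
    using sum_list_map_eq_sum_count[of "\<lambda>x. x" ys] by (simp add: w_def)
  also have "\<dots> \<le> (\<Sum>g\<in>set ys. m * g)"
    by (intro sum_mono mult_le_mono1 count)
  also have "\<dots> \<le> (\<Sum>g\<in>set gs. m * g)"
    by (rule sum_mono2) (use ys in auto)
  finally show "\<exists>w k. w \<in> S \<and> w \<le> (\<Sum>g\<in>set gs. m * g) \<and> s = w + k * m \<and> ord s = ord w + k"
    using s ordw wS by auto
qed

text \<open>The order bounds the number k of copies of m, and w is bounded anyway. Each graded
  component thus has finitely many monomials.\<close>

lemma finite_ord_eq: "finite {s \<in> S. ord s = i}"
proof -
  obtain N where N: "\<forall>s\<in>S. \<exists>w k. w \<in> S \<and> w \<le> N \<and> s = w + k * m \<and> ord s = ord w + k"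
    using ord_decomposition by blast
  have "s \<le> N + i * m" if s: "s \<in> S" "ord s = i" for s
  proof -
    obtain w k where "w \<le> N" "s = w + k * m" "ord s = ord w + k" using bspec[OF N s(1)] by blast
    then show ?thesis using s by (simp add: add_mono)
  qed
  then show ?thesis by (intro finite_subset[OF _ finite_atMost[of "N + i * m"]]) auto
qed

lemma ord_defect_bounded: obtains N where "\<And>s. s \<in> S \<Longrightarrow> s - ord s * m \<le> N"
proof -
  obtain N where N: "\<forall>s\<in>S. \<exists>w k. w \<in> S \<and> w \<le> N \<and> s = w + k * m \<and> ord s = ord w + k"
    using ord_decomposition by blast
  have "s - ord s * m \<le> N" if s: "s \<in> S" for s
  proof -
    obtain w k where "w \<le> N" "s = w + k * m" "ord s = ord w + k" using bspec[OF N s] by blast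
    then show ?thesis by (simp add: algebra_simps)
  qed
  with that show ?thesis by blast
qed

subsection \<open>Apery sets\<close>

text \<open>From a factorisation into at least h generators subtract m from every generator and give
  back the surplus copies of m; conversely each shifted generator needs one m to return to S. So S'
  collects the differences s - h m with s in hM, the semigroup of the blow-up.\<close>

lemma shifted_iff: "v \<in> shifted_semigroup gs \<longleftrightarrow> (\<exists>h. v + h * m \<in> mult_M S h)"
proof
  let ?A = "insert (hd gs) ((\<lambda>g. g - hd gs) ` set (tl gs))"
  assume "v \<in> shifted_semigroup gs"
  then have "v \<in> semigroup_span ?A" by (simp add: shifted_semigroup_def)
  then show "\<exists>h. v + h * m \<in> mult_M S h"
  proof induction
    case zero
    show ?case by (rule exI[of _ 0]) (simp add: mult_M_def)
  next
    case (add a v)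
    then obtain h where h: "v + h * m \<in> mult_M S h" by blast
    have gen1: "g \<in> mult_M S 1" if "g \<in> set gs" for g
      unfolding mult_M_iff using that by (intro exI[of _ "[g]"]) auto
    show ?case
    proof (cases "a = m")
      case True
      \<comment> \<open>The generator m is not shifted, so h stays as it is and the surplus order is
        dropped.\<close>
      have "m + (v + h * m) \<in> mult_M S (1 + h)" by (intro mult_M_add gen1 m_gen h)
      then have "m + (v + h * m) \<in> mult_M S h" by (rule mult_M_mono) simp
      then show ?thesis using True by (auto simp: add.assoc)
    next
      case False
      then obtain g where g: "g \<in> set (tl gs)" "a = g - m" using add(1) by (auto simp: m_def)
      then have "g \<in> set gs" "m < g" using tl_gt gen_cases by auto
      then have "g + (v + h * m) \<in> mult_M S (1 + h)" by (intro mult_M_add gen1 h)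
      moreover have "g + (v + h * m) = (a + v) + (1 + h) * m" using g \<open>m < g\<close> by simp
      ultimately show ?thesis by metis
    qed
  qed
next
  let ?S' = "shifted_semigroup gs"
  note S'_def = shifted_semigroup_def
  assume "\<exists>h. v + h * m \<in> mult_M S h"
  then obtain h xs where xs: "set xs \<subseteq> set gs" "sum_list xs = v + h * m" "h \<le> length xs"
    unfolding mult_M_iff by blast
  have gen': "g - m \<in> ?S'" if "g \<in> set gs" for g
  proof (cases "g = m")
    case True
    then show ?thesis by (simp add: S'_def semigroup_span.zero)
  next
    case False
    then show ?thesis using that gen_cases unfolding S'_def m_def
      by (intro semigroup_span_gen) blast
  qed
  have "sum_list (map (\<lambda>x. x - m) xs) \<in> ?S'"
    unfolding S'_def by (rule semigroup_span_sum_list) (use xs gen' in \<open>auto simp: S'_def\<close>)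
  moreover have "(length xs - h) * m \<in> ?S'"
    unfolding S'_def by (intro semigroup_span_mult semigroup_span_gen) (simp add: m_def)
  ultimately have "sum_list (map (\<lambda>x. x - m) xs) + (length xs - h) * m \<in> ?S'"
    unfolding S'_def by (rule semigroup_span_add)
  moreover have "sum_list (map (\<lambda>x. x - m) xs) + length xs * m = sum_list xs"
    using xs(1) by (induction xs) (use gen_ge in fastforce)+
  then have "sum_list (map (\<lambda>x. x - m) xs) + (length xs - h) * m = v"
    using xs(2) mult_le_mono1[OF xs(3), of m] unfolding diff_mult_distrib by linarith
  ultimately show "v \<in> ?S'" by simp
qed

abbreviation \<omega> :: "nat \<Rightarrow> nat" where "\<omega> i \<equiv> apery S m i"
abbreviation \<omega>' :: "nat \<Rightarrow> nat" where "\<omega>' i \<equiv> apery (shifted_semigroup gs) m i"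

lemma apery_mem: "\<omega> i \<in> S" and apery_mod: "\<omega> i mod m = i mod m"
proof -
  obtain s where "s \<in> S" "s mod m = i mod m" using S_residue[of i] by blast
  then show "\<omega> i \<in> S" "\<omega> i mod m = i mod m" by (rule apery_props)+
qed

lemma apery_le: "s \<in> S \<Longrightarrow> s mod m = i mod m \<Longrightarrow> \<omega> i \<le> s"
  by (rule apery_props)

lemma S_shifted: "s \<in> S \<Longrightarrow> s \<in> shifted_semigroup gs"
  unfolding shifted_iff by (rule exI[of _ 0]) (simp add: mult_M_def)

lemma apery_shifted_mem: "\<omega>' i \<in> shifted_semigroup gs" and apery_shifted_mod: "\<omega>' i mod m = i mod m"
  by (rule apery_props[OF S_shifted[OF apery_mem] apery_mod])+

lemma apery_shifted_le: "s \<in> shifted_semigroup gs \<Longrightarrow> s mod m = i mod m \<Longrightarrow> \<omega>' i \<le> s"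
  by (rule apery_props)

lemma shifted_add:
  "s \<in> shifted_semigroup gs \<Longrightarrow> t \<in> shifted_semigroup gs \<Longrightarrow> s + t \<in> shifted_semigroup gs"
  unfolding shifted_semigroup_def by (rule semigroup_span_add)

lemma add_multE:
  fixes x y :: nat
  assumes "x \<le> y" "x mod m = y mod m"
  obtains k where "y = x + k * m"
  using assms by (metis mod_eq_nat2E mult.commute)

definition a_nat :: "nat \<Rightarrow> nat" where "a_nat i = (\<omega> i - \<omega>' i) div m"

lemma apery_eq_shifted: "\<omega> i = \<omega>' i + a_nat i * m"
proof -
  obtain k where k: "\<omega> i = \<omega>' i + k * m"
    using add_multE[OF apery_shifted_le[OF S_shifted[OF apery_mem] apery_mod]] apery_mod apery_shifted_mod by metis
  then show ?thesis by (simp add: a_nat_def)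
qed

lemma a_num_eq: "a_num gs i = int (a_nat i)"
  unfolding a_num_def m_def[symmetric] S_def[symmetric]
proof (rule the_equality)
  show "int (\<omega>' i) + int (a_nat i) * int m = int (\<omega> i)" by (subst apery_eq_shifted) simp
  fix x assume "int (\<omega>' i) + x * int m = int (\<omega> i)"
  moreover have "int (\<omega>' i) + int (a_nat i) * int m = int (\<omega> i)" by (subst apery_eq_shifted) simp
  ultimately have "x * int m = int (a_nat i) * int m" by linarith
  then show "x = int (a_nat i)" using m_pos by simp
qed

lemma b_num_eq: "b_num gs i = ord (\<omega> i)"
proof -
  have "{l. \<omega> i \<in> mult_M S l} = {..ord (\<omega> i)}" using mult_M_iff_ord[OF apery_mem] by auto
  then show ?thesis unfolding b_num_def m_def[symmetric] S_def[symmetric]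
    by (auto intro: Max_eqI)
qed

text \<open>s - m ord(s) lies in S' by \<open>shifted_iff\<close> and has the residue of s, so it is
  at least the Apery element of S' in that class. The index of \<open>\<omega>'\<close> is s itself,
  as only its residue matters.\<close>

lemma ord_le_shift:
  assumes "s \<in> S" shows "\<omega>' s + ord s * m \<le> s"
proof -
  have le: "ord s * m \<le> s" by (rule ord_bound) fact
  have "s - ord s * m \<in> shifted_semigroup gs"
    unfolding shifted_iff using le mult_M_ord[OF assms] by (intro exI[of _ "ord s"]) (simp only: le_add_diff_inverse2)
  moreover have "(s - ord s * m) mod m = s mod m"
    using le by (metis le_add_diff_inverse2 mod_mult_self3 add.commute)
  ultimately have "\<omega>' s \<le> s - ord s * m" by (rule apery_shifted_le)
  with le show ?thesis by linarith
qed

lemma apery_shifted_cong: "i mod m = j mod m \<Longrightarrow> \<omega>' i = \<omega>' j"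
  by (simp add: apery_def)

lemma b_le_a: "ord (\<omega> i) \<le> a_nat i"
proof -
  have "\<omega>' i + ord (\<omega> i) * m \<le> \<omega>' i + a_nat i * m"
    using ord_le_shift[OF apery_mem, of i] apery_shifted_cong[OF apery_mod, of i] by (simp flip: apery_eq_shifted)
  then show ?thesis using m_pos by simp
qed

section \<open>Additivity of the order and the equalities a_i = b_i\<close>

lemma ord_add_mult_m_if_additive:
  assumes "\<forall>s\<in>S. ord (s + m) = ord s + 1" "s \<in> S"
  shows "ord (s + k * m) = ord s + k"
proof (induction k)
  case (Suc k)
  have "s + k * m \<in> S" using assms(2) by simp
  then have "ord ((s + k * m) + m) = ord (s + k * m) + 1" using assms(1) by blast
  with Suc show ?case by (simp add: ac_simps)
qed simp

text \<open>Adding a_i m to an element \<open>\<omega>' i + h * m\<close> of hM gives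
  \<open>\<omega> i + h * m\<close>, of order at least h + a_i; by additivity this order is b_i + h,
  so a_i <= b_i.\<close>

lemma a_eq_b_if_additive:
  assumes "\<forall>s\<in>S. ord (s + m) = ord s + 1"
  shows "a_nat i = ord (\<omega> i)"
proof -
  obtain h where h: "\<omega>' i + h * m \<in> mult_M S h" using apery_shifted_mem shifted_iff by blast
  have "a_nat i * m \<in> mult_M S (a_nat i)" using mult_M_ord[OF S_mult_m] by simp
  from mult_M_add[OF h this] have "\<omega> i + h * m \<in> mult_M S (h + a_nat i)"
    by (subst apery_eq_shifted) (simp add: ac_simps)
  then have "h + a_nat i \<le> ord (\<omega> i) + h"
    using ord_leI ord_add_mult_m_if_additive[OF assms apery_mem] by metis
  then show ?thesis using b_le_a[of i] by simp
qed

text \<open>The order of \<open>\<omega> i + k * m\<close> is at least b_i + k by superadditivity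
  and at most a_i + k by \<open>ord_le_shift\<close>. When the bounds agree, adding m raises the
  order by exactly one.\<close>

lemma additive_if_a_eq_b:
  assumes "\<forall>i<m. a_nat i = ord (\<omega> i)" "s \<in> S"
  shows "ord (s + m) = ord s + 1"
proof -
  have eq: "ord t = ord (\<omega> i) + k" if t: "t = \<omega> i + k * m" "i < m" for t i k
  proof (rule antisym)
    have tS: "t \<in> S" using t apery_mem by simp
    have "ord (\<omega> i) + ord (k * m) \<le> ord t" unfolding t(1) by (intro ord_add_ge apery_mem S_mult_m)
    then show "ord (\<omega> i) + k \<le> ord t" by simp
    have "t mod m = i mod m" using t apery_mod by simp
    then have "\<omega>' i + ord t * m \<le> \<omega>' i + a_nat i * m + k * m"
      using ord_le_shift[OF tS] apery_shifted_cong[of t i] by (simp add: t(1) flip: apery_eq_shifted)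
    then have "ord t * m \<le> (a_nat i + k) * m" by (simp add: algebra_simps)
    then have "ord t \<le> a_nat i + k" using m_pos by simp
    then show "ord t \<le> ord (\<omega> i) + k" using assms(1) t(2) by simp
  qed
  define i where "i = s mod m"
  have "i < m" by (simp add: i_def)
  have "\<omega> i \<le> s" "\<omega> i mod m = s mod m" using apery_le[OF assms(2)] apery_mod by (auto simp: i_def)
  then obtain k where k: "s = \<omega> i + k * m" by (rule add_multE)
  have "ord (s + m) = ord (\<omega> i) + (k + 1)" by (rule eq[OF _ \<open>i < m\<close>]) (simp add: k)
  moreover have "ord s = ord (\<omega> i) + k" by (rule eq[OF k \<open>i < m\<close>])
  ultimately show ?thesis by simp
qed

lemma le_M_trans:
  assumes "u \<in> S" "le_M S u u'" "le_M S u' u''"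
  shows "le_M S u u''"
proof -
  obtain s where s: "s \<in> S" "u + s = u'" "ord u + ord s = ord u'"
    using assms(2) unfolding le_M_def by blast
  obtain t where t: "t \<in> S" "u' + t = u''" "ord u' + ord t = ord u''"
    using assms(3) unfolding le_M_def by blast
  have "ord s + ord t \<le> ord (s + t)" by (rule ord_add_ge) fact+
  moreover have "u + (s + t) = u''" using s t by simp
  then have "ord u + ord (s + t) \<le> ord u''"
    using ord_add_ge[OF assms(1) S_add[OF s(1) t(1)]] by simp
  ultimately have "ord u + ord (s + t) = ord u''" using s t by linarith
  then show ?thesis unfolding le_M_def using s t by (intro bexI[of _ "s + t"]) auto
qed

text \<open>\<open>le_M\<close> implies the usual order and the Apery set is finite, so the
  numerically largest Apery element above the given one is maximal.\<close>

lemma ex_max_apery: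
  assumes "i < m"
  obtains j where "j < m" "\<omega> j \<in> max_apery_M S m" "le_M S (\<omega> i) (\<omega> j)"
proof -
  define B where "B = {v \<in> apery_set S m. le_M S (\<omega> i) v}"
  have "finite B" unfolding B_def apery_set_def by simp
  have "\<omega> i \<in> B" unfolding B_def apery_set_def le_M_def using assms
    by (auto intro!: bexI[of _ 0])
  define v where "v = Max B"
  have vB: "v \<in> B" unfolding v_def using \<open>finite B\<close> \<open>\<omega> i \<in> B\<close> by (intro Max_in) auto
  then obtain j where j: "j < m" "v = \<omega> j" unfolding B_def apery_set_def by auto
  have "u = v" if u: "u \<in> apery_set S m" "le_M S v u" for u
  proof (rule antisym)
    have "le_M S (\<omega> i) u" using le_M_trans[OF apery_mem] vB u(2) unfolding B_def by blast
    then show "u \<le> v" unfolding v_def using u(1) \<open>finite B\<close> by (intro Max_ge) (auto simp: B_def)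
    show "v \<le> u" using u(2) unfolding le_M_def by auto
  qed
  then have "v \<in> max_apery_M S m" using vB unfolding max_apery_M_def B_def by auto
  with j vB that show ?thesis unfolding B_def by auto
qed

text \<open>The \<open>a\<^sub>i\<close> are superadditive along \<open>\<le>\<^sub>M\<close> and the \<open>b\<^sub>i\<close> are additive, so \<open>b\<^sub>i \<le> a\<^sub>i\<close> turns
  equality at an element into equality at everything below it.\<close>

lemma a_eq_b_downward:
  assumes le: "le_M S (\<omega> i) (\<omega> j)" and eq: "a_nat j = ord (\<omega> j)"
  shows "a_nat i = ord (\<omega> i)"
proof -
  obtain s where s: "s \<in> S" "\<omega> i + s = \<omega> j" "ord (\<omega> i) + ord s = ord (\<omega> j)"
    using le unfolding le_M_def by blast
  have "\<omega> s \<le> s" by (rule apery_le[OF s(1)]) simp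
  then obtain k where k: "s = \<omega> s + k * m" by (rule add_multE) (simp add: apery_mod)
  \<comment> \<open>The summand s is itself an Apery element: otherwise m could be subtracted from
    \<open>\<omega> j\<close> within S.\<close>
  have "k = 0"
  proof (rule ccontr)
    assume "k \<noteq> 0"
    then have wj: "\<omega> j = \<omega> i + \<omega> s + (k - 1) * m + m" using s(2) k by (cases k) auto
    moreover have "\<omega> i + \<omega> s + (k - 1) * m \<in> S" by (intro S_add apery_mem S_mult_m)
    moreover have "(\<omega> i + \<omega> s + (k - 1) * m) mod m = j mod m"
      using apery_mod[of j] unfolding wj by simp
    ultimately show False using apery_le[of "\<omega> i + \<omega> s + (k - 1) * m" j] m_pos by linarith
  qed
  then have ws: "\<omega> s = s" using k by simp
  have "(\<omega>' i + \<omega>' s) mod m = (\<omega> i + \<omega> s) mod m"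
    using apery_mod apery_shifted_mod by (metis mod_add_cong)
  then have "(\<omega>' i + \<omega>' s) mod m = j mod m" using s(2) ws apery_mod by metis
  \<comment> \<open>Minimality makes \<open>\<omega>'\<close> subadditive here, while
    \<open>\<omega>\<close> is additive; the difference gives a_i + a_s <= a_j.\<close>
  then have "\<omega>' j \<le> \<omega>' i + \<omega>' s" by (intro apery_shifted_le shifted_add apery_shifted_mem)
  moreover have "\<omega>' j + a_nat j * m = \<omega>' i + a_nat i * m + (\<omega>' s + a_nat s * m)"
    using s(2) ws by (simp flip: apery_eq_shifted)
  ultimately have "(a_nat i + a_nat s) * m \<le> a_nat j * m" by (simp add: algebra_simps)
  then have "a_nat i + a_nat s \<le> a_nat j" using m_pos by simp
  moreover have "ord s \<le> a_nat s" using b_le_a[of s] ws by simp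
  ultimately show ?thesis using b_le_a[of i] eq s(3) by linarith
qed

theorem max_apery_iff_additive:
  "(\<forall>i<m. \<omega> i \<in> max_apery_M S m \<longrightarrow> a_num gs i = int (b_num gs i)) \<longleftrightarrow>
   (\<forall>s\<in>S. ord (s + m) = ord s + 1)"
proof
  assume max: "\<forall>i<m. \<omega> i \<in> max_apery_M S m \<longrightarrow> a_num gs i = int (b_num gs i)"
  have "a_nat i = ord (\<omega> i)" if i: "i < m" for i
  proof -
    obtain j where j: "j < m" "\<omega> j \<in> max_apery_M S m" "le_M S (\<omega> i) (\<omega> j)"
      by (rule ex_max_apery[OF i])
    have "a_nat j = ord (\<omega> j)" using max j by (simp add: a_num_eq b_num_eq)
    then show ?thesis by (rule a_eq_b_downward[OF j(3)])
  qed
  then show "\<forall>s\<in>S. ord (s + m) = ord s + 1" using additive_if_a_eq_b by blast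
next
  assume "\<forall>s\<in>S. ord (s + m) = ord s + 1"
  then show "\<forall>i<m. \<omega> i \<in> max_apery_M S m \<longrightarrow> a_num gs i = int (b_num gs i)"
    using a_eq_b_if_additive by (simp add: a_num_eq b_num_eq)
qed

end

section \<open>The tangent cone in monomial coordinates\<close>

definition ord_additive :: "nat set \<Rightarrow> nat \<Rightarrow> nat \<Rightarrow> bool" where
  "ord_additive S i j \<longleftrightarrow> i \<in> S \<and> j \<in> S \<and> ord_M S i + ord_M S j = ord_M S (i + j)"

text \<open>A function \<open>f\<close> stands for the element \<open>\<Sum>\<^sub>s f(s) x\<^sup>s\<close>.\<close>

definition tangent_cone :: "nat set \<Rightarrow> (nat \<Rightarrow> 'k::field) ring" where
  "tangent_cone S =
     \<lparr>carrier = {f. finite {s. f s \<noteq> 0} \<and> (\<forall>s. f s \<noteq> 0 \<longrightarrow> s \<in> S)},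
      monoid.mult = (\<lambda>f g n. \<Sum>i=0..n. if ord_additive S i (n - i) then f i * g (n - i) else 0),
      one = (\<lambda>n. if n = 0 then 1 else 0), ring.zero = (\<lambda>n. 0), add = (\<lambda>f g n. f n + g n)\<rparr>"

definition monomial :: "'k::field \<Rightarrow> nat \<Rightarrow> nat \<Rightarrow> 'k" where
  "monomial c s = (\<lambda>n. if n = s then c else 0)"

context numerical_semigroup
begin

text \<open>By superadditivity, either side says that ord(i + j + k) is the sum of the three orders.
  This is associativity of the truncated product on monomials.\<close>

lemma ord_additive_assoc:
  "ord_additive S i j \<and> ord_additive S (i + j) k \<longleftrightarrow>
   ord_additive S i (j + k) \<and> ord_additive S j k"
proof (cases "i \<in> S \<and> j \<in> S \<and> k \<in> S")
  case True
  then have c: "i \<in> S" "j \<in> S" "k \<in> S" "i + j \<in> S" "j + k \<in> S" by auto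
  have "ord i + ord j \<le> ord (i + j)" "ord (i + j) + ord k \<le> ord (i + j + k)"
    "ord j + ord k \<le> ord (j + k)" "ord i + ord (j + k) \<le> ord (i + j + k)"
    using ord_add_ge[OF c(1,2)] ord_add_ge[OF c(4,3)] ord_add_ge[OF c(2,3)] ord_add_ge[OF c(1,5)]
    by (simp_all add: add.assoc)
  then show ?thesis using c unfolding ord_additive_def by (auto simp: add.assoc)
qed (auto simp: ord_additive_def)

lemma ord_additive_commute: "ord_additive S i j \<longleftrightarrow> ord_additive S j i"
  by (auto simp: ord_additive_def ac_simps)

lemma ord_additive_zero: "s \<in> S \<Longrightarrow> ord_additive S 0 s"
  by (simp add: ord_additive_def)

lemma ord_additive_mult_m: "ord_additive S (j * m) (k * m)"
  using ord_mult_m[of "j + k"] by (simp add: ord_additive_def add_mult_distrib)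

text \<open>m ord(i) <= i and m ord(j) <= j add up to an equality, so both are equalities. Monomials
  whose nonzero product is a power of T are therefore powers of T themselves.\<close>

lemma ord_additive_dvd:
  assumes "ord_additive S i j" "i + j = k * m"
  shows "m dvd i"
proof -
  have c: "i \<in> S" "j \<in> S" "ord i + ord j = k"
    using assms ord_mult_m[of k] by (auto simp: ord_additive_def)
  have "i = ord i * m"
    using ord_bound[OF c(1)] ord_bound[OF c(2)] assms(2) unfolding c(3)[symmetric] add_mult_distrib
    by linarith
  then show ?thesis by (metis dvd_triv_right)
qed

abbreviation A :: "(nat \<Rightarrow> 'k::field) ring" where "A \<equiv> tangent_cone S"

lemma A_mult: "(f \<otimes>\<^bsub>A\<^esub> g) n =
    (\<Sum>i=0..n. if ord_additive S i (n - i) then f i * g (n - i) else 0)"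
  and A_one: "\<one>\<^bsub>A\<^esub> = (\<lambda>n. if n = 0 then 1 else 0)"
  and A_zero: "\<zero>\<^bsub>A\<^esub> = (\<lambda>n. 0)"
  and A_add: "(f \<oplus>\<^bsub>A\<^esub> g) n = f n + g n"
  by (simp_all add: tangent_cone_def)

lemma A_carrierI:
  assumes "finite B" "\<And>s. f s \<noteq> 0 \<Longrightarrow> s \<in> B \<and> s \<in> S"
  shows "f \<in> carrier A"
  using assms finite_subset[of "{s. f s \<noteq> 0}" B] by (auto simp: tangent_cone_def)

lemma A_carrierD:
  assumes "f \<in> carrier A"
  shows "finite {s. f s \<noteq> 0}" "f s \<noteq> 0 \<Longrightarrow> s \<in> S"
  using assms by (auto simp: tangent_cone_def)

lemma A_mult_nz:
  assumes "(f \<otimes>\<^bsub>A\<^esub> g) n \<noteq> 0"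
  obtains i where "i \<le> n" "ord_additive S i (n - i)" "f i \<noteq> 0" "g (n - i) \<noteq> 0"
proof -
  obtain i where "i \<in> {0..n}" "(if ord_additive S i (n - i) then f i * g (n - i) else 0) \<noteq> 0"
    using assms unfolding A_mult by (rule sum.not_neutral_contains_not_neutral)
  with that show ?thesis by (auto split: if_splits)
qed

lemma A_mult_closed:
  assumes "f \<in> carrier A" "g \<in> carrier A"
  shows "f \<otimes>\<^bsub>A\<^esub> g \<in> carrier A"
proof (rule A_carrierI)
  let ?B = "(\<lambda>(i, j). i + j) ` ({s. f s \<noteq> 0} \<times> {s. g s \<noteq> 0})"
  show "finite ?B" using assms A_carrierD(1) by blast
  fix n assume "(f \<otimes>\<^bsub>A\<^esub> g) n \<noteq> 0"
  then obtain i where i: "i \<le> n" "f i \<noteq> 0" "g (n - i) \<noteq> 0" by (rule A_mult_nz)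
  then have "i \<in> S" "n - i \<in> S" using assms A_carrierD(2) by blast+
  then have "i + (n - i) \<in> S" by (rule S_add)
  moreover have "n \<in> ?B" using i by (auto intro!: image_eqI[of _ _ "(i, n - i)"])
  ultimately show "n \<in> ?B \<and> n \<in> S" using i by simp
qed

lemma A_mult_assoc: "(f \<otimes>\<^bsub>A\<^esub> g) \<otimes>\<^bsub>A\<^esub> h = f \<otimes>\<^bsub>A\<^esub> (g \<otimes>\<^bsub>A\<^esub> h)"
proof
  fix n
  \<comment> \<open>With the truncation moved into F, the index shift for ordinary convolutions
    applies.\<close>
  define F where "F i j k = (if ord_additive S i j \<and> ord_additive S (i + j) k
    then f i * g j * h k else 0)" for i j k
  have "((f \<otimes>\<^bsub>A\<^esub> g) \<otimes>\<^bsub>A\<^esub> h) n = (\<Sum>j=0..n. \<Sum>i=0..j. F i (j - i) (n - j))"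
    unfolding A_mult F_def by (intro sum.cong refl) (auto simp: sum_distrib_right intro!: sum.cong)
  also have "\<dots> = (\<Sum>j=0..n. \<Sum>i=0..n - j. F j i (n - j - i))"
    by (rule fps_mult_assoc_lemma)
  also have "\<dots> = (f \<otimes>\<^bsub>A\<^esub> (g \<otimes>\<^bsub>A\<^esub> h)) n"
    unfolding A_mult
  proof (intro sum.cong refl)
    fix j assume "j \<in> {0..n}"
    have "F j i (n - j - i) = (if ord_additive S j (n - j) \<and> ord_additive S i (n - j - i)
       then f j * (g i * h (n - j - i)) else 0)" if "i \<in> {0..n - j}" for i
    proof -
      have "i + (n - j - i) = n - j" using that by simp
      then show ?thesis
        using ord_additive_assoc[of j i "n - j - i"] unfolding F_def by (simp add: mult.assoc)
    qed
    then have "(\<Sum>i=0..n - j. F j i (n - j - i)) = (\<Sum>i=0..n - j.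
       (if ord_additive S j (n - j) \<and> ord_additive S i (n - j - i)
       then f j * (g i * h (n - j - i)) else 0))"
      by (intro sum.cong) auto
    also have "\<dots> = (if ord_additive S j (n - j)
      then f j * (\<Sum>i=0..n - j. if ord_additive S i (n - j - i) then g i * h (n - j - i) else 0) else 0)"
      by (auto simp: sum_distrib_left intro!: sum.cong)
    finally show "(\<Sum>i=0..n - j. F j i (n - j - i)) = \<dots>" .
  qed
  finally show "((f \<otimes>\<^bsub>A\<^esub> g) \<otimes>\<^bsub>A\<^esub> h) n = (f \<otimes>\<^bsub>A\<^esub> (g \<otimes>\<^bsub>A\<^esub> h)) n" .
qed

lemma A_mult_commute: "f \<otimes>\<^bsub>A\<^esub> g = g \<otimes>\<^bsub>A\<^esub> f"
proof
  fix n
  let ?F = "\<lambda>i j. if ord_additive S i j then f i * g j else 0"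
  have "(f \<otimes>\<^bsub>A\<^esub> g) n = (\<Sum>i=0..n. ?F (n - i) i)"
    unfolding A_mult by (rule fps_mult_commute_lemma)
  then show "(f \<otimes>\<^bsub>A\<^esub> g) n = (g \<otimes>\<^bsub>A\<^esub> f) n"
    unfolding A_mult by (auto simp: ord_additive_commute mult.commute intro!: sum.cong)
qed

lemma monomial_mult_left:
  "(monomial c s \<otimes>\<^bsub>A\<^esub> f) n = (if s \<le> n \<and> ord_additive S s (n - s) then c * f (n - s) else 0)"
proof -
  have "(monomial c s \<otimes>\<^bsub>A\<^esub> f) n =
      (\<Sum>i=0..n. if i = s then (if ord_additive S s (n - s) then c * f (n - s) else 0) else 0)"
    unfolding A_mult by (intro sum.cong) (auto simp: monomial_def)
  then show ?thesis by (simp add: sum.delta)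
qed

lemma A_cring: "cring (A :: (nat \<Rightarrow> 'k::field) ring)"
proof (rule cringI)
  show "abelian_group (A :: (nat \<Rightarrow> 'k) ring)"
  proof (rule abelian_groupI)
    fix f g :: "nat \<Rightarrow> 'k" assume f: "f \<in> carrier A"
    show "f \<oplus>\<^bsub>A\<^esub> g \<in> carrier A" if g: "g \<in> carrier A"
      by (rule A_carrierI[of "{s. f s \<noteq> 0} \<union> {s. g s \<noteq> 0}"])
        (use A_carrierD(1)[OF f] A_carrierD(1)[OF g] A_carrierD(2)[OF f] A_carrierD(2)[OF g]
          in \<open>force simp: A_add\<close>)+
    have "(\<lambda>n. - f n) \<in> carrier A"
      by (rule A_carrierI[of "{s. f s \<noteq> 0}"]) (use A_carrierD[OF f] in auto)
    then show "\<exists>g\<in>carrier A. g \<oplus>\<^bsub>A\<^esub> f = \<zero>\<^bsub>A\<^esub>"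
      by (rule bexI[rotated]) (auto simp: A_add A_zero)
  qed (auto simp: A_add A_zero fun_eq_iff intro: A_carrierI[of "{}"])
  show "comm_monoid (A :: (nat \<Rightarrow> 'k) ring)"
  proof (rule comm_monoidI)
    have one: "\<one>\<^bsub>A\<^esub> = monomial (1::'k) 0" by (simp add: A_one monomial_def)
    show "\<one>\<^bsub>A\<^esub> \<in> carrier (A :: (nat \<Rightarrow> 'k) ring)"
      unfolding one by (rule A_carrierI[of "{0}"]) (auto simp: monomial_def split: if_splits)
    fix f :: "nat \<Rightarrow> 'k" assume f: "f \<in> carrier A"
    show "\<one>\<^bsub>A\<^esub> \<otimes>\<^bsub>A\<^esub> f = f"
    proof
      fix n show "(\<one>\<^bsub>A\<^esub> \<otimes>\<^bsub>A\<^esub> f) n = f n"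
        unfolding one monomial_mult_left using A_carrierD(2)[OF f, of n] ord_additive_zero[of n]
        by (cases "n \<in> S") auto
    qed
  qed (blast intro: A_mult_closed A_mult_assoc A_mult_commute)+
  fix f g h :: "nat \<Rightarrow> 'k"
  show "(f \<oplus>\<^bsub>A\<^esub> g) \<otimes>\<^bsub>A\<^esub> h = f \<otimes>\<^bsub>A\<^esub> h \<oplus>\<^bsub>A\<^esub> g \<otimes>\<^bsub>A\<^esub> h"
    by (rule ext) (auto simp: A_mult A_add sum.distrib[symmetric] algebra_simps intro!: sum.cong)
qed

section \<open>The retraction of the tangent cone onto K[X]\<close>

definition A_sec :: "'k::field poly \<Rightarrow> nat \<Rightarrow> 'k" where
  "A_sec p n = (if m dvd n then coeff p (n div m) else 0)"

text \<open>Keeps the monomials at multiples of m, which are the powers of T, and kills the others.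
  \<open>Abs_poly\<close> returns these coefficients only for finite support, as the carrier
  guarantees.\<close>

definition A_pr :: "(nat \<Rightarrow> 'k::field) \<Rightarrow> 'k poly" where
  "A_pr f = Abs_poly (\<lambda>k. f (k * m))"

lemma A_sec_mult_m [simp]: "A_sec p (k * m) = coeff p k"
  using m_pos by (simp add: A_sec_def)

lemma A_sec_closed: "A_sec p \<in> carrier A"
proof (rule A_carrierI[of "(\<lambda>k. k * m) ` {..degree p}"])
  fix s assume "A_sec p s \<noteq> 0"
  then have "s = s div m * m" "coeff p (s div m) \<noteq> 0" by (auto simp: A_sec_def split: if_splits)
  then obtain k where k: "s = k * m" "coeff p k \<noteq> 0" by blast
  then show "s \<in> (\<lambda>k. k * m) ` {..degree p} \<and> s \<in> S" using le_degree by auto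
qed auto

lemma coeff_A_pr:
  assumes "f \<in> carrier A" shows "coeff (A_pr f) k = f (k * m)"
proof -
  obtain N where N: "s \<le> N" if "f s \<noteq> 0" for s
    using A_carrierD(1)[OF assms] by (auto simp: finite_nat_set_iff_bounded_le)
  have "f (k * m) = 0" if "N < k" for k
  proof (rule ccontr)
    assume "f (k * m) \<noteq> 0"
    then have "k * m \<le> N" by (rule N)
    moreover have "k * 1 \<le> k * m" by (intro mult_le_mono) (use m_pos in linarith)+
    ultimately show False using that by linarith
  qed
  then have "coeff (A_pr f) = (\<lambda>k. f (k * m))" unfolding A_pr_def by (rule coeff_Abs_poly)
  then show ?thesis by simp
qed

lemma A_pr_sec: "A_pr (A_sec p) = p"
  by (rule poly_eqI) (simp add: coeff_A_pr A_sec_closed)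

text \<open>By \<open>ord_additive_dvd\<close> the coefficient at k m only sees pairs of multiples
  of m, and on those the truncation is never active.\<close>

lemma A_pr_mult:
  assumes "f \<in> carrier A" "g \<in> carrier A"
  shows "A_pr (f \<otimes>\<^bsub>A\<^esub> g) = A_pr f * A_pr g"
proof (rule poly_eqI)
  fix k
  let ?F = "\<lambda>i. if ord_additive S i (k * m - i) then f i * g (k * m - i) else 0"
  have "coeff (A_pr (f \<otimes>\<^bsub>A\<^esub> g)) k = sum ?F {0..k * m}"
    using assms by (simp add: coeff_A_pr A_mult_closed A_mult)
  also have "\<dots> = sum ?F ((\<lambda>j. j * m) ` {..k})"
  proof (rule sum.mono_neutral_right)
    show "\<forall>i\<in>{0..k * m} - (\<lambda>j. j * m) ` {..k}. ?F i = 0"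
    proof
      fix i assume i: "i \<in> {0..k * m} - (\<lambda>j. j * m) ` {..k}"
      have "\<not> m dvd i"
      proof
        assume "m dvd i"
        then obtain j where "i = j * m" by (metis dvdE mult.commute)
        with i show False using m_pos by auto
      qed
      then have "\<not> ord_additive S i (k * m - i)" using ord_additive_dvd[of i "k * m - i" k] i by auto
      then show "?F i = 0" by simp
    qed
  qed (auto simp: mult_le_mono1)
  also have "\<dots> = (\<Sum>j\<le>k. ?F (j * m))"
    by (subst sum.reindex) (use m_pos in \<open>auto simp: inj_on_def\<close>)
  also have "\<dots> = (\<Sum>j\<le>k. coeff (A_pr f) j * coeff (A_pr g) (k - j))"
    using ord_additive_mult_m
    by (intro sum.cong) (auto simp: coeff_A_pr assms simp flip: diff_mult_distrib)
  finally show "coeff (A_pr (f \<otimes>\<^bsub>A\<^esub> g)) k = coeff (A_pr f * A_pr g) k"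
    by (simp add: coeff_mult)
qed

lemma A_pr_hom: "A_pr \<in> ring_hom A (poly_ring :: 'k::field poly ring)"
proof (rule ring_hom_memI)
  interpret A: cring "A :: (nat \<Rightarrow> 'k) ring" by (rule A_cring)
  show "A_pr \<one>\<^bsub>A\<^esub> = \<one>\<^bsub>poly_ring :: 'k poly ring\<^esub>"
    using A.one_closed m_pos by (intro poly_eqI) (auto simp: coeff_A_pr poly_ring_def A_one)
  fix f g :: "nat \<Rightarrow> 'k" assume fg: "f \<in> carrier A" "g \<in> carrier A"
  show "A_pr (f \<otimes>\<^bsub>A\<^esub> g) = A_pr f \<otimes>\<^bsub>poly_ring\<^esub> A_pr g"
    using fg by (simp add: poly_ring_def A_pr_mult)
  show "A_pr (f \<oplus>\<^bsub>A\<^esub> g) = A_pr f \<oplus>\<^bsub>poly_ring\<^esub> A_pr g"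
    using fg A.a_closed[OF fg] by (intro poly_eqI) (simp add: coeff_A_pr poly_ring_def A_add)
qed (simp add: poly_ring_def)

lemma A_sec_hom: "A_sec \<in> ring_hom (poly_ring :: 'k::field poly ring) A"
proof (rule ring_hom_memI)
  show "A_sec \<one>\<^bsub>poly_ring :: 'k poly ring\<^esub> = \<one>\<^bsub>A\<^esub>"
    using m_pos by (auto simp: poly_ring_def A_one A_sec_def fun_eq_iff)
  fix p q :: "'k poly"
  show "A_sec p \<in> carrier A" by (rule A_sec_closed)
  show "A_sec (p \<oplus>\<^bsub>poly_ring\<^esub> q) = A_sec p \<oplus>\<^bsub>A\<^esub> A_sec q"
    by (rule ext) (simp add: poly_ring_def A_add A_sec_def)
  show "A_sec (p \<otimes>\<^bsub>poly_ring\<^esub> q) = A_sec p \<otimes>\<^bsub>A\<^esub> A_sec q"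
  proof
    fix n
    show "A_sec (p \<otimes>\<^bsub>poly_ring\<^esub> q) n = (A_sec p \<otimes>\<^bsub>A\<^esub> A_sec q) n"
    proof (cases "m dvd n")
      case True
      then obtain k where k: "n = k * m" by (metis dvdE mult.commute)
      have "(A_sec p \<otimes>\<^bsub>A\<^esub> A_sec q) n = coeff (A_pr (A_sec p \<otimes>\<^bsub>A\<^esub> A_sec q)) k"
        by (simp add: coeff_A_pr A_mult_closed A_sec_closed k)
      also have "\<dots> = coeff (p * q) k" by (simp add: A_pr_mult A_sec_closed A_pr_sec)
      finally show ?thesis by (simp add: k poly_ring_def)
    next
      case False
      have "(A_sec p \<otimes>\<^bsub>A\<^esub> A_sec q) n = 0"
      proof (rule ccontr)
        assume "(A_sec p \<otimes>\<^bsub>A\<^esub> A_sec q) n \<noteq> 0"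
        then obtain i where "i \<le> n" "A_sec p i \<noteq> 0" "A_sec q (n - i) \<noteq> 0" by (rule A_mult_nz)
        then have "m dvd i + (n - i)" by (intro dvd_add) (auto simp: A_sec_def split: if_splits)
        then show False using False \<open>i \<le> n\<close> by simp
      qed
      then show ?thesis using False by (simp add: A_sec_def)
    qed
  qed
qed

text \<open>\<open>s - m ord(s)\<close> is a second grading of the tangent cone. It is bounded, and its degree \<open>0\<close> part
  is the image of \<open>K[X]\<close>; hence the kernel of the projection to \<open>K[X]\<close> is nil.\<close>

lemma A_nil:
  fixes f :: "nat \<Rightarrow> 'k::field"
  assumes f: "f \<in> carrier A" and pr: "A_pr f = 0"
  shows "\<exists>n::nat. f [^]\<^bsub>A\<^esub> n = \<zero>\<^bsub>A\<^esub>"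
proof -
  interpret A: cring "A :: (nat \<Rightarrow> 'k) ring" by (rule A_cring)
  obtain N where N: "\<And>s. s \<in> S \<Longrightarrow> s - ord s * m \<le> N" using ord_defect_bounded by blast
  \<comment> \<open>Coefficients in degree 0 of the second grading are those of
    \<open>A_pr f\<close>, hence zero: f lives in degrees at least 1.\<close>
  have fz: "1 \<le> s - ord s * m" if "f s \<noteq> 0" for s
  proof (rule ccontr)
    assume "\<not> ?thesis"
    then have "s = ord s * m" using ord_bound A_carrierD(2)[OF f that] by fastforce
    moreover have "f (ord s * m) = 0" using coeff_A_pr[OF f, of "ord s"] pr by simp
    ultimately show False using that by simp
  qed
  \<comment> \<open>The degrees add up along nonzero products, so the n-th power of f lives in
    degrees at least n; the exponent N + 1 then exceeds the bound N.\<close>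
  have pow: "n \<le> s - ord s * m" if "(f [^]\<^bsub>A\<^esub> n) s \<noteq> 0" for n s
    using that
  proof (induction n arbitrary: s)
    case (Suc n)
    then have "(f [^]\<^bsub>A\<^esub> n \<otimes>\<^bsub>A\<^esub> f) s \<noteq> 0" by simp
    then obtain i where i: "i \<le> s" "ord_additive S i (s - i)" "(f [^]\<^bsub>A\<^esub> n) i \<noteq> 0" "f (s - i) \<noteq> 0"
      by (rule A_mult_nz)
    have c: "i \<in> S" "s - i \<in> S" "ord i + ord (s - i) = ord s" using i by (auto simp: ord_additive_def)
    have "ord i * m \<le> i" "ord (s - i) * m \<le> s - i" using ord_bound c by auto
    moreover have "n \<le> i - ord i * m" "1 \<le> (s - i) - ord (s - i) * m" using Suc.IH[OF i(3)] fz[OF i(4)] by blast+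
    moreover have "ord s * m = ord i * m + ord (s - i) * m"
      unfolding c(3)[symmetric] by (rule add_mult_distrib)
    ultimately show ?case using i(1) by linarith
  qed simp
  have "(f [^]\<^bsub>A\<^esub> (N + 1)) s = 0" for s
  proof (rule ccontr)
    assume nz: "(f [^]\<^bsub>A\<^esub> (N + 1)) s \<noteq> 0"
    then have "s \<in> S" using A_carrierD(2)[OF A.nat_pow_closed[OF f]] by blast
    then show False using pow[OF nz] N[of s] by linarith
  qed
  then have "f [^]\<^bsub>A\<^esub> (N + 1) = \<zero>\<^bsub>A\<^esub>" unfolding A_zero by (rule ext)
  then show ?thesis by blast
qed

section \<open>Finite generation over K[X] and regularity of T\<close>

lemma monomial_closed: "s \<in> S \<Longrightarrow> monomial c s \<in> carrier A"
  by (rule A_carrierI[of "{s}"]) (auto simp: monomial_def split: if_splits)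

lemma A_sec_monom: "A_sec (monom c k) = monomial c (k * m)"
  using m_pos by (auto simp: A_sec_def monomial_def fun_eq_iff)

text \<open>In s = w + k m with ord(s) = ord(w) + k the monomial x^s equals T^k x^w, so the finitely
  many monomials with exponent at most N generate over K[X].\<close>

lemma A_fg: "\<exists>W. finite W \<and> W \<subseteq> carrier A \<and>
    carrier (A :: (nat \<Rightarrow> 'k::field) ring) \<subseteq> poly_span A A_sec W"
proof -
  interpret poly_algebra "A :: (nat \<Rightarrow> 'k) ring" A_sec
    by (intro poly_algebra.intro poly_algebra_axioms.intro A_cring A_sec_hom)
  obtain N where N: "\<forall>s\<in>S. \<exists>w k. w \<in> S \<and> w \<le> N \<and> s = w + k * m \<and> ord s = ord w + k"
    using ord_decomposition by blast
  define W :: "(nat \<Rightarrow> 'k) set" where "W = monomial 1 ` {w \<in> S. w \<le> N}"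
  have Wc: "W \<subseteq> carrier A" using monomial_closed by (auto simp: W_def)
  have monomial_span: "monomial c s \<in> poly_span A A_sec W" if s: "s \<in> S" for c s
  proof -
    obtain w k where w: "w \<in> S" "w \<le> N" "s = w + k * m" "ord s = ord w + k"
      using bspec[OF N s] by blast
    have "ord_additive S (k * m) w" using w by (simp add: ord_additive_def ac_simps)
    then have "monomial c s = A_sec (monom c k) \<otimes>\<^bsub>A\<^esub> monomial 1 w \<oplus>\<^bsub>A\<^esub> \<zero>\<^bsub>A\<^esub>"
      unfolding A_sec_monom unfolding fun_eq_iff A_add A_zero monomial_mult_left
      by (auto simp: monomial_def w(3))
    then show ?thesis using w by (simp add: W_def poly_span.intros)
  qed
  have "f \<in> poly_span A A_sec W" if "f \<in> carrier A" for f
    using that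
  proof (induction "card {s. f s \<noteq> 0}" arbitrary: f rule: less_induct)
    case less
    show ?case
    proof (cases "f = \<zero>\<^bsub>A\<^esub>")
      case True
      then show ?thesis by (simp add: poly_span.zero)
    next
      case False
      then obtain s where s: "f s \<noteq> 0" by (auto simp: A_zero fun_eq_iff)
      note fin = A_carrierD(1)[OF less.prems]
      have g: "f(s := 0) \<in> carrier A"
        by (rule A_carrierI[OF fin]) (use A_carrierD(2)[OF less.prems] in \<open>auto split: if_splits\<close>)
      have "{t. (f(s := 0)) t \<noteq> 0} \<subset> {t. f t \<noteq> 0}" using s by auto
      then have "f(s := 0) \<in> poly_span A A_sec W"
        using less.hyps[OF psubset_card_mono[OF fin] g] by blast
      then have "monomial (f s) s \<oplus>\<^bsub>A\<^esub> f(s := 0) \<in> poly_span A A_sec W"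
        by (intro poly_span_add Wc monomial_span A_carrierD(2)[OF less.prems s])
      moreover have "monomial (f s) s \<oplus>\<^bsub>A\<^esub> f(s := 0) = f"
        by (rule ext) (auto simp: A_add monomial_def)
      ultimately show ?thesis by simp
    qed
  qed
  then show ?thesis using Wc by (intro exI[of _ W]) (auto simp: W_def)
qed

text \<open>T sends x^s to x^(s + m) or to 0, and shifting keeps distinct monomials distinct, so T
  is regular once it kills no monomial.\<close>

lemma A_nzd_iff: "nzd (A :: (nat \<Rightarrow> 'k::field) ring) (A_sec [:0, 1:]) \<longleftrightarrow>
    (\<forall>s\<in>S. ord (s + m) = ord s + 1)"
proof -
  have X: "A_sec [:0, 1:] = monomial (1::'k) m"
    using A_sec_monom[of "1::'k" 1] by (simp add: monom_altdef)
  have ordm: "ord m = 1" using ord_mult_m[of 1] by simp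
  have mS: "m \<in> S" using S_mult_m[of 1] by simp
  show ?thesis
  proof
    assume nz: "nzd (A :: (nat \<Rightarrow> 'k) ring) (A_sec [:0, 1:])"
    show "\<forall>s\<in>S. ord (s + m) = ord s + 1"
    proof
      fix s assume s: "s \<in> S"
      have "monomial (1::'k) s \<noteq> \<zero>\<^bsub>A\<^esub>" by (auto simp: monomial_def A_zero fun_eq_iff)
      then have "monomial 1 m \<otimes>\<^bsub>A\<^esub> monomial (1::'k) s \<noteq> \<zero>\<^bsub>A\<^esub>"
        using nz monomial_closed[OF s, of "1::'k"] unfolding X nzd_def by blast
      then obtain n where "(monomial 1 m \<otimes>\<^bsub>A\<^esub> monomial (1::'k) s) n \<noteq> 0" by (auto simp: A_zero fun_eq_iff)
      then have "m \<le> n \<and> ord_additive S m (n - m) \<and> monomial (1::'k) s (n - m) \<noteq> 0"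
        unfolding monomial_mult_left by (auto split: if_splits)
      then have "ord_additive S m s" by (auto simp: monomial_def split: if_splits)
      then show "ord (s + m) = ord s + 1" by (simp add: ord_additive_def ordm add.commute)
    qed
  next
    assume add: "\<forall>s\<in>S. ord (s + m) = ord s + 1"
    show "nzd (A :: (nat \<Rightarrow> 'k) ring) (A_sec [:0, 1:])"
      unfolding X nzd_def
    proof (intro ballI impI)
      fix f :: "nat \<Rightarrow> 'k" assume f: "f \<in> carrier A" "monomial 1 m \<otimes>\<^bsub>A\<^esub> f = \<zero>\<^bsub>A\<^esub>"
      show "f = \<zero>\<^bsub>A\<^esub>"
      proof (rule ccontr)
        assume "f \<noteq> \<zero>\<^bsub>A\<^esub>"
        then obtain s where s: "f s \<noteq> 0" by (auto simp: A_zero fun_eq_iff)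
        then have "s \<in> S" using A_carrierD(2)[OF f(1)] by blast
        then have "ord_additive S m s" using bspec[OF add, of s] ordm mS
          by (simp add: ord_additive_def add.commute[of m])
        then have "(monomial 1 m \<otimes>\<^bsub>A\<^esub> f) (s + m) = f s" by (simp add: monomial_mult_left)
        then show False using s f(2) by (simp add: A_zero)
      qed
    qed
  qed
qed

text \<open>For the lowest exponents j of p and d of f, the coefficient of the product at j m + d
  comes from that one pair; regularity of T makes the orders of j m and d add up, so the term
  survives.\<close>

lemma A_nzd_sec:
  fixes p :: "'k::field poly"
  assumes T: "nzd (A :: (nat \<Rightarrow> 'k) ring) (A_sec [:0, 1:])" and p: "p \<noteq> 0"
  shows "nzd A (A_sec p)"
  unfolding nzd_def
proof (intro ballI impI)
  fix f :: "nat \<Rightarrow> 'k" assume f: "f \<in> carrier A" "A_sec p \<otimes>\<^bsub>A\<^esub> f = \<zero>\<^bsub>A\<^esub>"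
  show "f = \<zero>\<^bsub>A\<^esub>"
  proof (rule ccontr)
    assume "f \<noteq> \<zero>\<^bsub>A\<^esub>"
    then have ex: "\<exists>s. f s \<noteq> 0" by (auto simp: A_zero fun_eq_iff)
    define d where "d = (LEAST s. f s \<noteq> 0)"
    have d: "f d \<noteq> 0" using LeastI_ex[OF ex] unfolding d_def .
    have fd: "f s = 0" if "s < d" for s using not_less_Least[OF that[unfolded d_def]] by simp
    have ex': "\<exists>j. coeff p j \<noteq> 0" using p by (metis leading_coeff_0_iff)
    define j where "j = (LEAST j. coeff p j \<noteq> 0)"
    have j: "coeff p j \<noteq> 0" using LeastI_ex[OF ex'] unfolding j_def .
    have pj: "coeff p i = 0" if "i < j" for i
      using not_less_Least[OF that[unfolded j_def]] by simp
    let ?n = "j * m + d"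
    let ?F = "\<lambda>i. if ord_additive S i (?n - i) then A_sec p i * f (?n - i) else 0"
    have dS: "d \<in> S" using A_carrierD(2)[OF f(1) d] .
    have "ord_additive S (j * m) d"
      using ord_add_mult_m_if_additive[OF T[unfolded A_nzd_iff] dS, of j] dS
      by (simp add: ord_additive_def add.commute)
    then have Fj: "?F (j * m) = coeff p j * f d" by simp
    have "?F i = 0" if i: "i \<noteq> j * m" "i \<le> ?n" for i
    proof (cases "i < j * m")
      case True
      have "A_sec p i = 0"
      proof (cases "m dvd i")
        case True
        then obtain k where "i = k * m" by (metis dvdE mult.commute)
        with \<open>i < j * m\<close> show ?thesis using pj by simp
      qed (simp add: A_sec_def)
      then show ?thesis by simp
    next
      case False
      then have "?n - i < d" using i by linarith
      then show ?thesis using fd by simp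
    qed
    then have "(A_sec p \<otimes>\<^bsub>A\<^esub> f) ?n = ?F (j * m)"
      unfolding A_mult by (subst sum.remove[of _ "j * m"]) auto
    then show False using Fj j d f(2) by (simp add: A_zero)
  qed
qed

end

section \<open>The associated graded ring of \<open>K[[t\<^sup>S]]\<close>\<close>

lemma sum_mem_add_closed:
  assumes "finite B" "0 \<in> J" "\<And>x y. x \<in> J \<Longrightarrow> y \<in> J \<Longrightarrow> x + y \<in> J" "\<And>b. b \<in> B \<Longrightarrow> f b \<in> J"
  shows "sum f B \<in> J"
  using assms by (induction B rule: finite_induct) auto

context numerical_semigroup
begin

abbreviation R :: "'k::field fps ring" where "R \<equiv> semigroup_ring S"

text \<open>The h-th power of the maximal ideal, described by exponents; \<open>I 0\<close> is the
  ring itself. The identification is \<open>ideal_power_eq\<close>.\<close>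

definition I :: "nat \<Rightarrow> 'k::field fps set" where
  "I h = {f. \<forall>n. fps_nth f n \<noteq> 0 \<longrightarrow> n \<in> mult_M S h}"

lemma R_simps: "carrier R = I 0" "f \<otimes>\<^bsub>R\<^esub> g = f * g" "f \<oplus>\<^bsub>R\<^esub> g = f + g"
  "\<one>\<^bsub>R\<^esub> = 1" "\<zero>\<^bsub>R\<^esub> = 0"
  by (auto simp: semigroup_ring_def I_def mult_M_def)

lemma I_zero: "0 \<in> I h"
  by (simp add: I_def)

lemma I_add: "f \<in> I h \<Longrightarrow> g \<in> I h \<Longrightarrow> f + g \<in> I h"
  by (force simp: I_def)

lemma I_diff: "f \<in> I h \<Longrightarrow> g \<in> I h \<Longrightarrow> f - g \<in> I h"
  by (force simp: I_def)

lemma I_mult: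
  assumes "f \<in> I h" "g \<in> I k" shows "f * g \<in> I (h + k)"
  unfolding I_def
proof (intro CollectI allI impI)
  fix n assume "fps_nth (f * g) n \<noteq> 0"
  then obtain i where i: "i \<in> {0..n}" "fps_nth f i * fps_nth g (n - i) \<noteq> 0"
    unfolding fps_mult_nth by (rule sum.not_neutral_contains_not_neutral)
  then have "i + (n - i) \<in> mult_M S (h + k)"
    using assms by (intro mult_M_add) (auto simp: I_def)
  with i(1) show "n \<in> mult_M S (h + k)" by simp
qed

lemma I_antimono: "h \<le> k \<Longrightarrow> I k \<subseteq> I h"
  using mult_M_mono by (auto simp: I_def)

lemma R_cring: "cring (R :: 'k::field fps ring)"
proof (rule cringI)
  show "abelian_group (R :: 'k fps ring)"
  proof (rule abelian_groupI)
    fix f :: "'k fps" assume "f \<in> carrier R"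
    then show "\<exists>g\<in>carrier R. g \<oplus>\<^bsub>R\<^esub> f = \<zero>\<^bsub>R\<^esub>"
      by (intro bexI[of _ "- f"]) (auto simp: R_simps I_def)
  qed (auto simp: R_simps I_zero I_add add_ac)
  show "comm_monoid (R :: 'k fps ring)"
  proof (rule comm_monoidI)
    show "\<one>\<^bsub>R\<^esub> \<in> carrier (R :: 'k fps ring)" by (auto simp: R_simps I_def mult_M_def)
    show "f \<otimes>\<^bsub>R\<^esub> g \<in> carrier R" if "f \<in> carrier R" "g \<in> carrier R" for f g :: "'k fps"
      using that I_mult[of f 0 g 0] by (simp add: R_simps)
  qed (simp_all add: R_simps mult_ac)
qed (simp add: R_simps algebra_simps)

lemma R_minus:
  assumes "f \<in> carrier R" "g \<in> carrier R" shows "f \<ominus>\<^bsub>R\<^esub> g = f - g"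
proof -
  interpret cring R by (rule R_cring)
  have "- g \<in> carrier R" using assms by (simp add: R_simps I_def)
  then have "\<ominus>\<^bsub>R\<^esub> g = - g" using assms(2) by (intro minus_equality) (auto simp: R_simps)
  then show ?thesis by (simp add: a_minus_def R_simps)
qed

lemma I_ideal: "ideal (I h) (R :: 'k::field fps ring)"
proof -
  interpret cring "R :: 'k fps ring" by (rule R_cring)
  show ?thesis
  proof (rule idealI[OF ring_axioms])
    show "subgroup (I h) (add_monoid (R :: 'k fps ring))"
    proof (rule add.subgroupI)
      show "I h \<subseteq> carrier (R :: 'k fps ring)" using I_antimono[of 0 h] by (simp add: R_simps)
      show "I h \<noteq> ({} :: 'k fps set)" using I_zero by blast
      show "f \<oplus>\<^bsub>R\<^esub> g \<in> I h" if "f \<in> I h" "g \<in> I h" for f g :: "'k fps"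
        using that I_add by (simp add: R_simps)
      show "\<ominus>\<^bsub>R\<^esub> f \<in> I h" if f: "f \<in> I h" for f :: "'k fps"
      proof -
        have fc: "f \<in> carrier R" using f I_antimono[of 0 h] by (auto simp: R_simps)
        have "\<ominus>\<^bsub>R\<^esub> f = \<zero>\<^bsub>R\<^esub> \<ominus>\<^bsub>R\<^esub> f" using fc by (simp add: minus_eq)
        also have "\<dots> = 0 - f" unfolding R_minus[OF zero_closed fc] by (simp add: R_simps)
        finally have "\<ominus>\<^bsub>R\<^esub> f = 0 - f" .
        then show ?thesis using I_diff[OF I_zero f] by simp
      qed
    qed
    fix f g :: "'k fps" assume "f \<in> I h" "g \<in> carrier R"
    then show "g \<otimes>\<^bsub>R\<^esub> f \<in> I h" "f \<otimes>\<^bsub>R\<^esub> g \<in> I h"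
      using I_mult[of g 0 f h] I_mult[of f h g 0] by (auto simp: R_simps)
  qed
qed

text \<open>Each exponent in (h + 1)M is a generator plus an element of hM. Sorting the terms of f
  by a chosen generator \<gamma>(n) writes f as a finite sum of X^g u_g, although f may have
  infinitely many terms. J is any set closed under sums, so that the lemma serves generated ideals
  and products of ideals alike.\<close>

lemma I_Suc_decompose:
  fixes f :: "'k::field fps"
  assumes f: "f \<in> I (Suc h)" and J: "0 \<in> J" "\<And>x y. x \<in> J \<Longrightarrow> y \<in> J \<Longrightarrow> x + y \<in> J"
    and gen: "\<And>g u. g \<in> set gs \<Longrightarrow> u \<in> I h \<Longrightarrow> fps_X ^ g * u \<in> J"
  shows "f \<in> J"
proof -
  have "\<exists>g. g \<in> set gs \<and> g \<le> n \<and> n - g \<in> mult_M S h" if n: "n \<in> mult_M S (Suc h)" for n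
  proof -
    obtain xs where xs: "set xs \<subseteq> set gs" "sum_list xs = n" "Suc h \<le> length xs"
      using n unfolding mult_M_iff by blast
    then obtain g ys where "xs = g # ys" by (cases xs) auto
    with xs show ?thesis unfolding mult_M_iff by (intro exI[of _ g]) auto
  qed
  then obtain \<gamma> where \<gamma>: "\<gamma> n \<in> set gs" "\<gamma> n \<le> n" "n - \<gamma> n \<in> mult_M S h"
    if "n \<in> mult_M S (Suc h)" for n
    by metis
  define u where "u g = Abs_fps (\<lambda>n. if n + g \<in> mult_M S (Suc h) \<and> \<gamma> (n + g) = g
    then fps_nth f (n + g) else 0)" for g
  have "u g \<in> I h" for g
    using \<gamma>(3) by (fastforce simp: u_def I_def split: if_splits)
  then have "(\<Sum>g\<in>set gs. fps_X ^ g * u g) \<in> J"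
    by (intro sum_mem_add_closed[OF _ J] gen) auto
  moreover have "(\<Sum>g\<in>set gs. fps_X ^ g * u g) = f"
  proof (rule fps_ext)
    fix n
    have "fps_nth (\<Sum>g\<in>set gs. fps_X ^ g * u g) n =
        (\<Sum>g\<in>set gs. if g = \<gamma> n then (if n \<in> mult_M S (Suc h) then fps_nth f n else 0) else 0)"
      unfolding fps_sum_nth
      by (intro sum.cong) (auto simp: fps_X_power_mult_nth u_def \<gamma>(2) not_less dest: \<gamma>(2))
    also have "\<dots> = fps_nth f n"
      using f \<gamma>(1)[of n] by (auto simp: sum.delta' sum.delta I_def)
    finally show "fps_nth (\<Sum>g\<in>set gs. fps_X ^ g * u g) n = fps_nth f n" .
  qed
  ultimately show ?thesis by simp
qed

lemma X_power_mem: "g \<in> set gs \<Longrightarrow> fps_X ^ g \<in> I 1"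
  unfolding I_def mult_M_iff by (auto split: if_splits intro!: exI[of _ "[g]"])

lemma semigroup_ideal_eq: "semigroup_ideal gs = I 1"
proof
  interpret cring R by (rule R_cring)
  let ?X = "(\<lambda>g. fps_X ^ g) ` set gs :: 'a fps set"
  have X: "?X \<subseteq> I 1" using X_power_mem by auto
  then have Xc: "?X \<subseteq> carrier R" using I_antimono[of 0 1] by (auto simp: R_simps)
  have eq: "semigroup_ideal gs = Idl\<^bsub>R\<^esub> ?X" by (simp add: semigroup_ideal_def S_def)
  show "semigroup_ideal gs \<subseteq> (I 1 :: 'a fps set)"
    unfolding eq using genideal_minimal[OF I_ideal X] .
  interpret J: ideal "Idl\<^bsub>R\<^esub> ?X" R by (rule genideal_ideal[OF Xc])
  show "(I 1 :: 'a fps set) \<subseteq> semigroup_ideal gs"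
  proof
    fix f :: "'a fps" assume f: "f \<in> I 1"
    show "f \<in> semigroup_ideal gs"
      unfolding eq
    proof (rule I_Suc_decompose[of f 0])
      show "f \<in> I (Suc 0)" using f by simp
      show "0 \<in> Idl\<^bsub>R\<^esub> ?X" using J.zero_closed by (simp add: R_simps)
      show "x + y \<in> Idl\<^bsub>R\<^esub> ?X" if "x \<in> Idl\<^bsub>R\<^esub> ?X" "y \<in> Idl\<^bsub>R\<^esub> ?X" for x y
        using J.a_closed[OF that] by (simp add: R_simps)
      show "fps_X ^ g * u \<in> Idl\<^bsub>R\<^esub> ?X" if "g \<in> set gs" "u \<in> I 0" for g u
      proof -
        have "fps_X ^ g \<in> Idl\<^bsub>R\<^esub> ?X" using genideal_self[OF Xc] that by blast
        from J.I_r_closed[OF this, of u] that show ?thesis by (simp add: R_simps)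
      qed
    qed
  qed
qed

lemma ideal_power_eq: "ideal_power R (semigroup_ideal gs) h = (I h :: 'k::field fps set)"
proof (induction h)
  case 0
  then show ?case by (simp add: nat_pow_def ideals_set_def R_simps)
next
  case (Suc h)
  have "ideal_power R (semigroup_ideal gs) (Suc h) = ideal_prod R (I h) (I 1 :: 'k fps set)"
    using Suc unfolding semigroup_ideal_eq by (simp add: nat_pow_def ideals_set_def)
  also have "\<dots> = I (Suc h)"
  proof
    show "ideal_prod R (I h) (I 1) \<subseteq> (I (Suc h) :: 'k fps set)"
    proof
      fix f :: "'k fps" assume "f \<in> ideal_prod R (I h) (I 1)"
      then show "f \<in> I (Suc h)"
      proof induction
        case (prod i j)
        then show ?case using I_mult[of i h j 1] by (simp add: R_simps)
      next
        case (sum s t)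
        then show ?case using I_add by (simp add: R_simps)
      qed
    qed
    show "(I (Suc h) :: 'k fps set) \<subseteq> ideal_prod R (I h) (I 1)"
    proof
      fix f :: "'k fps" assume "f \<in> I (Suc h)"
      then show "f \<in> ideal_prod R (I h) (I 1)"
      proof (rule I_Suc_decompose)
        show "0 \<in> ideal_prod R (I h) (I 1 :: 'k fps set)"
          using ideal_prod.prod[OF I_zero I_zero, where R = R] by (simp add: R_simps)
        show "x + y \<in> ideal_prod R (I h) (I 1)"
          if "x \<in> ideal_prod R (I h) (I 1)" "y \<in> ideal_prod R (I h) (I 1)" for x y :: "'k fps"
          using ideal_prod.sum[OF that] by (simp add: R_simps)
        show "fps_X ^ g * u \<in> ideal_prod R (I h) (I 1)" if "g \<in> set gs" "u \<in> I h" for g and u :: "'k fps"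
          using ideal_prod.prod[OF that(2) X_power_mem[OF that(1)], where R = R]
          by (simp add: R_simps mult.commute)
      qed
    qed
  qed
  finally show ?case .
qed

section \<open>The isomorphism from the monomial model to the graded ring\<close>

abbreviation G :: "(nat \<Rightarrow> 'k::field fps set) ring" where
  "G \<equiv> assoc_graded R (semigroup_ideal gs)"

abbreviation coset :: "nat \<Rightarrow> 'k::field fps \<Rightarrow> 'k fps set" where
  "coset h f \<equiv> I h +>\<^bsub>R\<^esub> f"

lemma coset_eq_iff:
  assumes "f \<in> carrier R" "g \<in> carrier R"
  shows "coset h f = coset h g \<longleftrightarrow> f - g \<in> I h"
proof -
  interpret cring R by (rule R_cring)
  show ?thesis
    using quotient_eq_iff_same_a_r_cos[OF I_ideal assms] R_minus[OF assms] by simp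
qed

lemma coset_def': "coset h f = {x + f | x. x \<in> I h}"
  by (auto simp: a_r_coset_def' R_simps)

lemma coset_zero: "coset h 0 = I h"
  by (simp add: coset_def')

lemma I_carrier: "f \<in> I h \<Longrightarrow> f \<in> carrier R"
  using I_antimono[of 0 h] by (auto simp: R_simps)

text \<open>\<open>rcoset_mult\<close> is a union over all representatives; changing them alters the
  product by x (y + g) + f y in \<open>I (i + j + 1)\<close>, so all members of the union
  coincide.\<close>

lemma rcoset_mult_coset:
  fixes f g :: "'k::field fps"
  assumes "f \<in> I i" "g \<in> I j"
  shows "rcoset_mult R (I (i + j + 1)) (coset (i + 1) f) (coset (j + 1) g) = coset (i + j + 1) (f * g)"
proof -
  have "coset (i + j + 1) ((x + f) * (y + g)) = coset (i + j + 1) (f * g)"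
    if xy: "x \<in> I (i + 1)" "y \<in> I (j + 1)" for x y
  proof -
    have "x \<in> I i" "y \<in> I j" using xy I_antimono[of i "i + 1"] I_antimono[of j "j + 1"] by auto
    then have c: "(x + f) * (y + g) \<in> I (i + j)" "f * g \<in> I (i + j)"
      using assms by (auto intro!: I_mult I_add)
    have "(x + f) * (y + g) - f * g = x * (y + g) + f * y" by (simp add: algebra_simps)
    also have "\<dots> \<in> I (i + j + 1)"
    proof (rule I_add)
      have "x * (y + g) \<in> I ((i + 1) + j)" using xy(1) \<open>y \<in> I j\<close> assms(2) by (intro I_mult I_add)
      then show "x * (y + g) \<in> I (i + j + 1)" by (simp add: ac_simps)
      have "f * y \<in> I (i + (j + 1))" using assms(1) xy(2) by (rule I_mult)
      then show "f * y \<in> I (i + j + 1)" by (simp add: ac_simps)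
    qed
    finally show ?thesis using coset_eq_iff c I_carrier by blast
  qed
  then have const: "coset (i + j + 1) (x \<otimes>\<^bsub>R\<^esub> y) = coset (i + j + 1) (f * g)"
    if "x \<in> coset (i + 1) f" "y \<in> coset (j + 1) g" for x y
    using that unfolding coset_def'[of "i + 1"] coset_def'[of "j + 1"] R_simps by blast
  have "f \<in> coset (i + 1) f" "g \<in> coset (j + 1) g"
    unfolding coset_def' using I_zero by force+
  then show ?thesis unfolding rcoset_mult_def using const by blast
qed

lemma finsum_coset:
  fixes f :: "nat \<Rightarrow> 'k::field fps"
  assumes "finite B" "\<And>b. b \<in> B \<Longrightarrow> f b \<in> carrier R"
  shows "finsum (R Quot I h) (\<lambda>b. coset h (f b)) B = coset h (sum f B)"
proof -
  interpret J: ideal "I h" "R :: 'k fps ring" by (rule I_ideal)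
  interpret Q: ring "R Quot (I h :: 'k fps set)" by (rule J.quotient_is_ring)
  have cos: "coset h x \<in> carrier (R Quot I h)" if "x \<in> carrier R" for x :: "'k fps"
    using that by (auto simp: FactRing_def A_RCOSETS_def')
  show ?thesis using assms
  proof (induction B rule: finite_induct)
    case empty
    then show ?case by (simp add: coset_zero) (simp add: FactRing_def)
  next
    case (insert b B)
    have s: "sum f B \<in> carrier R" unfolding R_simps
      by (rule sum_mem_add_closed) (use insert I_zero I_add in \<open>auto simp: R_simps\<close>)
    have "finsum (R Quot I h) (\<lambda>b. coset h (f b)) (insert b B)
        = coset h (f b) \<oplus>\<^bsub>R Quot I h\<^esub> finsum (R Quot I h) (\<lambda>b. coset h (f b)) B"
      using insert cos by (intro Q.finsum_insert) auto
    also have "\<dots> = coset h (f b) <+>\<^bsub>R\<^esub> coset h (sum f B)"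
      using insert by (simp add: FactRing_def)
    also have "\<dots> = coset h (f b + sum f B)"
      using J.a_rcos_sum[of "f b" "sum f B"] insert s by (simp add: R_simps)
    finally show ?case using insert by simp
  qed
qed

text \<open>A representative of the component of degree i: modulo \<open>I (i + 1)\<close> a series
  in \<open>I i\<close> is determined by its terms of order exactly i.\<close>

definition part :: "(nat \<Rightarrow> 'k::field) \<Rightarrow> nat \<Rightarrow> 'k fps" where
  "part f i = Abs_fps (\<lambda>s. if s \<in> S \<and> ord s = i then f s else 0)"

definition to_G :: "(nat \<Rightarrow> 'k::field) \<Rightarrow> nat \<Rightarrow> 'k fps set" where
  "to_G f i = coset (i + 1) (part f i)"

lemma part_mem: "part f i \<in> I i"
  by (auto simp: part_def I_def mult_M_iff_ord split: if_splits)

lemma part_carrier: "part f i \<in> carrier R"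
  using I_carrier[OF part_mem] .

lemma G_carrier: "carrier G = {u :: nat \<Rightarrow> 'k::field fps set.
    (\<forall>i. u i \<in> coset (i + 1) ` I i) \<and> finite {i. u i \<noteq> I (i + 1)}}"
  and G_mult: "(u \<otimes>\<^bsub>G\<^esub> v) k = finsum (R Quot I (k + 1))
    (\<lambda>i. rcoset_mult R (I (k + 1)) (u i) (v (k - i))) {..k}"
  and G_one: "\<one>\<^bsub>G\<^esub> = (\<lambda>i. if i = 0 then coset 1 1 else I (i + 1))"
  and G_zero: "\<zero>\<^bsub>G\<^esub> = (\<lambda>i. I (i + 1))"
  and G_add: "(u \<oplus>\<^bsub>G\<^esub> v) i = u i <+>\<^bsub>R\<^esub> v i"
  unfolding assoc_graded_def ideal_power_eq by (simp_all add: R_simps cong: if_cong)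

lemma to_G_closed:
  assumes "f \<in> carrier A"
  shows "to_G f \<in> carrier G"
proof -
  have "{i. to_G f i \<noteq> I (i + 1)} \<subseteq> ord ` {s. f s \<noteq> 0}"
  proof
    fix i assume "i \<in> {i. to_G f i \<noteq> I (i + 1)}"
    then have "part f i \<noteq> 0" by (auto simp: to_G_def coset_zero)
    then show "i \<in> ord ` {s. f s \<noteq> 0}" by (auto simp: part_def fps_eq_iff split: if_splits)
  qed
  then have "finite {i. to_G f i \<noteq> I (i + 1)}"
    using A_carrierD(1)[OF assms] by (meson finite_imageI finite_subset)
  then show ?thesis using part_mem by (auto simp: G_carrier to_G_def)
qed

text \<open>Both terms lie in \<open>I k\<close>, so only exponents n of order exactly k need
  comparing. There a pair (j, n - j) contributes precisely when its orders add up to k, which is the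
  truncation in \<open>tangent_cone\<close>; the index i is forced to be ord(j).\<close>

lemma part_mult:
  fixes f g :: "nat \<Rightarrow> 'k::field"
  shows "(\<Sum>i\<le>k. part f i * part g (k - i)) - part (f \<otimes>\<^bsub>A\<^esub> g) k \<in> I (k + 1)"
  unfolding I_def
proof (intro CollectI allI impI)
  fix n
  let ?P = "\<Sum>i\<le>k. part f i * part g (k - i)"
  assume nz: "fps_nth (?P - part (f \<otimes>\<^bsub>A\<^esub> g) k) n \<noteq> 0"
  have "?P \<in> I k"
  proof (rule sum_mem_add_closed)
    fix i assume "i \<in> {..k}"
    then show "part f i * part g (k - i) \<in> I k"
      using I_mult[OF part_mem[of f i] part_mem[of g "k - i"]] by simp
  qed (auto intro: I_zero I_add)
  then have "?P - part (f \<otimes>\<^bsub>A\<^esub> g) k \<in> I k" by (intro I_diff part_mem)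
  with nz have nk: "n \<in> mult_M S k" by (simp add: I_def)
  then have nS: "n \<in> S" by (rule mult_M_subset)
  have "ord n \<noteq> k"
  proof
    assume ord: "ord n = k"
    have "fps_nth ?P n = (\<Sum>i\<le>k. \<Sum>j=0..n. fps_nth (part f i) j * fps_nth (part g (k - i)) (n - j))"
      by (simp add: fps_sum_nth fps_mult_nth)
    also have "\<dots> = (\<Sum>j=0..n. \<Sum>i\<le>k. fps_nth (part f i) j * fps_nth (part g (k - i)) (n - j))"
      by (rule sum.swap)
    also have "\<dots> = (\<Sum>j=0..n. if ord_additive S j (n - j) then f j * g (n - j) else 0)"
    proof (intro sum.cong refl)
      fix j assume j: "j \<in> {0..n}"
      have "(\<Sum>i\<le>k. fps_nth (part f i) j * fps_nth (part g (k - i)) (n - j)) =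
          (\<Sum>i\<le>k. if i = ord j then (if ord_additive S j (n - j) then f j * g (n - j) else 0) else 0)"
        by (intro sum.cong) (use j ord in \<open>auto simp: part_def ord_additive_def\<close>)
      also have "\<dots> = (if ord_additive S j (n - j) then f j * g (n - j) else 0)"
        using j ord by (auto simp: sum.delta ord_additive_def)
      finally show "(\<Sum>i\<le>k. fps_nth (part f i) j * fps_nth (part g (k - i)) (n - j)) = \<dots>" .
    qed
    also have "\<dots> = fps_nth (part (f \<otimes>\<^bsub>A\<^esub> g) k) n"
      using nS ord by (simp add: part_def A_mult)
    finally show False using nz by simp
  qed
  with nk nS show "n \<in> mult_M S (k + 1)" by (simp add: mult_M_iff_ord)
qed

lemma to_G_iso: "to_G \<in> ring_iso (A :: (nat \<Rightarrow> 'k::field) ring) G"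
proof (rule ring_iso_memI)
  fix f g :: "nat \<Rightarrow> 'k" assume fg: "f \<in> carrier A" "g \<in> carrier A"
  show "to_G (f \<otimes>\<^bsub>A\<^esub> g) = to_G f \<otimes>\<^bsub>G\<^esub> to_G g"
  proof
    fix k
    have "rcoset_mult R (I (k + 1)) (to_G f i) (to_G g (k - i)) =
        coset (k + 1) (part f i * part g (k - i))" if "i \<in> {..k}" for i
      using rcoset_mult_coset[OF part_mem[of f i] part_mem[of g "k - i"]] that
      by (simp add: to_G_def)
    moreover have c: "part f i * part g (k - i) \<in> carrier R" if "i \<in> {..k}" for i
      using I_mult[OF part_mem[of f i] part_mem[of g "k - i"]] I_carrier by blast
    moreover interpret Q: ring "R Quot (I (k + 1) :: 'k fps set)"
      by (rule ideal.quotient_is_ring[OF I_ideal])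
    have "coset (k + 1) x \<in> carrier (R Quot I (k + 1))" if "x \<in> carrier R" for x :: "'k fps"
      using that by (auto simp: FactRing_def A_RCOSETS_def')
    ultimately have "(to_G f \<otimes>\<^bsub>G\<^esub> to_G g) k =
        finsum (R Quot I (k + 1)) (\<lambda>i. coset (k + 1) (part f i * part g (k - i))) {..k}"
      unfolding G_mult by (intro Q.finsum_cong') auto
    also have "\<dots> = coset (k + 1) (\<Sum>i\<le>k. part f i * part g (k - i))"
      by (rule finsum_coset) (use c in auto)
    also have "\<dots> = coset (k + 1) (part (f \<otimes>\<^bsub>A\<^esub> g) k)"
    proof (subst coset_eq_iff)
      show "(\<Sum>i\<le>k. part f i * part g (k - i)) \<in> carrier R"
        unfolding R_simps by (rule sum_mem_add_closed) (use c I_zero I_add in \<open>auto simp: R_simps\<close>)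
    qed (rule part_carrier part_mult)+
    finally show "to_G (f \<otimes>\<^bsub>A\<^esub> g) k = (to_G f \<otimes>\<^bsub>G\<^esub> to_G g) k" by (simp add: to_G_def)
  qed
  show "to_G (f \<oplus>\<^bsub>A\<^esub> g) = to_G f \<oplus>\<^bsub>G\<^esub> to_G g"
  proof
    fix i
    interpret J: ideal "I (i + 1)" "R :: 'k fps ring" by (rule I_ideal)
    have "part (f \<oplus>\<^bsub>A\<^esub> g) i = part f i + part g i"
      by (rule fps_ext) (simp add: part_def A_add)
    then show "to_G (f \<oplus>\<^bsub>A\<^esub> g) i = (to_G f \<oplus>\<^bsub>G\<^esub> to_G g) i"
      using J.a_rcos_sum[OF part_carrier[of f i] part_carrier[of g i]]
      by (simp add: G_add to_G_def R_simps)
  qed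
next
  have "part \<one>\<^bsub>A\<^esub> i = (if i = 0 then 1 else 0 :: 'k fps)" for i
    by (rule fps_ext) (auto simp: part_def A_one)
  then show "to_G \<one>\<^bsub>A\<^esub> = (\<one>\<^bsub>G\<^esub> :: nat \<Rightarrow> 'k fps set)"
    by (auto simp: to_G_def G_one coset_zero fun_eq_iff)
next
  show "bij_betw to_G (carrier A) (carrier (G :: (nat \<Rightarrow> 'k fps set) ring))"
  proof (rule bij_betwI')
    fix f g :: "nat \<Rightarrow> 'k" assume fg: "f \<in> carrier A" "g \<in> carrier A"
    show "to_G f = to_G g \<longleftrightarrow> f = g"
    proof
      assume eq: "to_G f = to_G g"
      show "f = g"
      proof
        fix s
        show "f s = g s"
        proof (cases "s \<in> S")
          case True
          have "coset (ord s + 1) (part f (ord s)) = coset (ord s + 1) (part g (ord s))"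
            using fun_cong[OF eq, of "ord s"] by (simp add: to_G_def)
          then have "part f (ord s) - part g (ord s) \<in> I (ord s + 1)"
            using coset_eq_iff part_carrier by blast
          then have "fps_nth (part f (ord s) - part g (ord s)) s = 0"
            using True by (auto simp: I_def mult_M_iff_ord)
          then show ?thesis using True by (simp add: part_def)
        next
          case False
          then show ?thesis using A_carrierD(2) fg by metis
        qed
      qed
    qed simp
  next
    fix u :: "nat \<Rightarrow> 'k fps set" assume u: "u \<in> carrier G"
    then have "\<forall>i. \<exists>a\<in>I i. u i = coset (i + 1) a" by (auto simp: G_carrier)
    then obtain \<alpha> where \<alpha>: "\<And>i. \<alpha> i \<in> I i" "\<And>i. u i = coset (i + 1) (\<alpha> i)" by metis
    \<comment> \<open>The coefficient at s is taken from the component of degree ord(s); terms of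
      \<alpha> i of order above i vanish in the coset.\<close>
    define f where "f s = (if s \<in> S then fps_nth (\<alpha> (ord s)) s else 0)" for s
    have "f \<in> carrier A"
    proof (rule A_carrierI)
      let ?B = "\<Union>i\<in>{i. u i \<noteq> I (i + 1)}. {s \<in> S. ord s = i}"
      show "finite ?B" using u finite_ord_eq by (auto simp: G_carrier)
      fix s assume s: "f s \<noteq> 0"
      then have sS: "s \<in> S" by (auto simp: f_def split: if_splits)
      have "u (ord s) \<noteq> I (ord s + 1)"
      proof
        assume "u (ord s) = I (ord s + 1)"
        then have "coset (ord s + 1) (\<alpha> (ord s)) = coset (ord s + 1) 0"
          using \<alpha>(2)[of "ord s"] by (simp add: coset_zero)
        then have "\<alpha> (ord s) - 0 \<in> I (ord s + 1)"
          using coset_eq_iff I_carrier[OF \<alpha>(1)] I_carrier[OF I_zero] by blast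
        then show False using s sS by (auto simp: f_def I_def mult_M_iff_ord)
      qed
      then show "s \<in> ?B \<and> s \<in> S" using sS by auto
    qed
    moreover have "u = to_G f"
    proof
      fix i
      have "\<alpha> i - part f i \<in> I (i + 1)"
        unfolding I_def
      proof (intro CollectI allI impI)
        fix n assume nz: "fps_nth (\<alpha> i - part f i) n \<noteq> 0"
        then have n: "n \<in> mult_M S i" using I_diff[OF \<alpha>(1) part_mem] by (auto simp: I_def)
        then have nS: "n \<in> S" by (rule mult_M_subset)
        have "ord n \<noteq> i" using nz nS by (auto simp: part_def f_def)
        with n nS show "n \<in> mult_M S (i + 1)" by (simp add: mult_M_iff_ord)
      qed
      then show "u i = to_G f i"
        unfolding to_G_def \<alpha>(2) using coset_eq_iff I_carrier[OF \<alpha>(1)] part_carrier by blast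
    qed
    ultimately show "\<exists>f\<in>carrier A. u = to_G f" by blast
  qed (rule to_G_closed)
qed (rule to_G_closed)

text \<open>Only products, powers, spans and nonzerodivisors are carried along the isomorphism; the
  nil extension is set up on G itself, so that depth, height and primes need no transport.\<close>

theorem cohen_macaulay_G_iff: "cohen_macaulay (G :: (nat \<Rightarrow> 'k::field fps set) ring) \<longleftrightarrow>
    (\<forall>s\<in>S. ord (s + m) = ord s + 1)"
proof -
  let ?A = "A :: (nat \<Rightarrow> 'k) ring" and ?G = "G :: (nat \<Rightarrow> 'k fps set) ring"
  interpret A: cring ?A by (rule A_cring)
  have bij: "bij_betw to_G (carrier ?A) (carrier ?G)" and hom: "to_G \<in> ring_hom ?A ?G"
    using to_G_iso by (auto simp: ring_iso_def)
  define inv_G where "inv_G = inv_into (carrier ?A) to_G"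
  have iso': "inv_G \<in> ring_iso ?G ?A"
    unfolding inv_G_def by (rule ring_iso_set_sym[OF A.ring_axioms to_G_iso])
  have inv_to: "inv_G (to_G f) = f" if "f \<in> carrier ?A" for f
    using bij that by (simp add: inv_G_def bij_betw_inv_into_left)
  have to_inv: "to_G (inv_G u) = u" "inv_G u \<in> carrier ?A" if "u \<in> carrier ?G" for u
    using bij that by (auto simp: inv_G_def bij_betw_inv_into_right bij_betw_def inv_into_into)
  \<comment> \<open>\<open>ring_iso\<close> does not speak of zero; this equation identifies the
    zero of the image ring with the zero field of G.\<close>
  have to_G_zero: "to_G \<zero>\<^bsub>?A\<^esub> = \<zero>\<^bsub>?G\<^esub>"
  proof -
    have "part (\<zero>\<^bsub>?A\<^esub>) i = 0" for i by (rule fps_ext) (simp add: part_def A_zero)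
    then show ?thesis by (auto simp: to_G_def G_zero coset_zero)
  qed
  have "cring ?G"
    using A.ring_iso_imp_img_cring[OF to_G_iso] to_G_zero by simp
  then interpret G: cring ?G .
  define \<sigma> where "\<sigma> p = to_G (A_sec p :: nat \<Rightarrow> 'k)" for p
  define \<pi> where "\<pi> u = A_pr (inv_G u)" for u
  have pow: "to_G (f [^]\<^bsub>?A\<^esub> (n::nat)) = to_G f [^]\<^bsub>?G\<^esub> n" if "f \<in> carrier ?A" for f n
  proof (induction n)
    case 0
    then show ?case using ring_hom_one[OF hom] by simp
  next
    case (Suc n)
    then show ?case using ring_hom_mult[OF hom A.nat_pow_closed[OF that] that] by simp
  qed
  have \<sigma>_hom: "\<sigma> \<in> ring_hom poly_ring ?G"
    using ring_hom_trans[OF A_sec_hom hom] by (simp add: \<sigma>_def[abs_def] comp_def)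
  interpret E: nil_extension ?G \<sigma> \<pi>
  proof (intro nil_extension.intro poly_algebra.intro poly_algebra_axioms.intro
      nil_extension_axioms.intro G.is_cring)
    show "\<sigma> \<in> ring_hom poly_ring ?G" by (rule \<sigma>_hom)
    have "inv_G \<in> ring_hom ?G ?A" using iso' by (simp add: ring_iso_def)
    from ring_hom_trans[OF this A_pr_hom] show "\<pi> \<in> ring_hom ?G poly_ring"
      by (simp add: \<pi>_def[abs_def] comp_def)
    show "\<pi> (\<sigma> p) = p" for p by (simp add: \<pi>_def \<sigma>_def inv_to A_sec_closed A_pr_sec)
    fix u assume u: "u \<in> carrier ?G" "\<pi> u = 0"
    then obtain n :: nat where "inv_G u [^]\<^bsub>?A\<^esub> n = \<zero>\<^bsub>?A\<^esub>"
      using A_nil[of "inv_G u"] to_inv by (auto simp: \<pi>_def)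
    then have "u [^]\<^bsub>?G\<^esub> n = \<zero>\<^bsub>?G\<^esub>" using pow[OF to_inv(2)[OF u(1)], of n]
        to_inv(1)[OF u(1)] to_G_zero by simp
    then show "\<exists>n::nat. u [^]\<^bsub>?G\<^esub> n = \<zero>\<^bsub>?G\<^esub>" by blast
  qed
  obtain W where W: "finite W" "W \<subseteq> carrier ?A" "carrier ?A \<subseteq> poly_span ?A A_sec W"
    using A_fg by blast
  have nzd: "nzd ?G (\<sigma> p) \<longleftrightarrow> nzd ?A (A_sec p)" for p
  proof
    assume n: "nzd ?G (\<sigma> p)"
    show "nzd ?A (A_sec p)" unfolding nzd_def
    proof (intro ballI impI)
      fix f assume f: "f \<in> carrier ?A" "A_sec p \<otimes>\<^bsub>?A\<^esub> f = \<zero>\<^bsub>?A\<^esub>"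
      have "\<sigma> p \<otimes>\<^bsub>?G\<^esub> to_G f = to_G (A_sec p \<otimes>\<^bsub>?A\<^esub> f)"
        using ring_hom_mult[OF hom A_sec_closed f(1), of p] by (simp only: \<sigma>_def)
      also have "\<dots> = \<zero>\<^bsub>?G\<^esub>" unfolding f(2) by (rule to_G_zero)
      finally have "\<sigma> p \<otimes>\<^bsub>?G\<^esub> to_G f = \<zero>\<^bsub>?G\<^esub>" .
      then have "to_G f = to_G \<zero>\<^bsub>?A\<^esub>" using n to_G_closed[OF f(1)] to_G_zero unfolding nzd_def by simp
      then show "f = \<zero>\<^bsub>?A\<^esub>" using inv_to f(1) A.zero_closed by metis
    qed
  next
    assume n: "nzd ?A (A_sec p)"
    show "nzd ?G (\<sigma> p)" unfolding nzd_def
    proof (intro ballI impI)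
      fix u assume u: "u \<in> carrier ?G" "\<sigma> p \<otimes>\<^bsub>?G\<^esub> u = \<zero>\<^bsub>?G\<^esub>"
      have "to_G (A_sec p \<otimes>\<^bsub>?A\<^esub> inv_G u) = to_G \<zero>\<^bsub>?A\<^esub>"
        using ring_hom_mult[OF hom A_sec_closed to_inv(2)[OF u(1)]] u to_G_zero to_inv(1)[OF u(1)]
        by (simp add: \<sigma>_def)
      then have "A_sec p \<otimes>\<^bsub>?A\<^esub> inv_G u = \<zero>\<^bsub>?A\<^esub>"
        using inv_to A.zero_closed A_mult_closed[OF A_sec_closed to_inv(2)[OF u(1)]] by metis
      then have "inv_G u = \<zero>\<^bsub>?A\<^esub>" using n to_inv(2)[OF u(1)] unfolding nzd_def by blast
      then show "u = \<zero>\<^bsub>?G\<^esub>" using to_inv(1)[OF u(1)] to_G_zero by simp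
    qed
  qed
  have Wc: "to_G ` W \<subseteq> carrier ?G" using W(2) to_G_closed by blast
  have span: "to_G f \<in> poly_span ?G \<sigma> (to_G ` W)" if "f \<in> poly_span ?A A_sec W" for f
  proof -
    have "f \<in> carrier ?A \<and> to_G f \<in> poly_span ?G \<sigma> (to_G ` W)" using that
    proof induction
      case zero
      then show ?case by (simp add: to_G_zero poly_span.zero)
    next
      case (add w v p)
      have w: "w \<in> carrier ?A" using add W by blast
      have pw: "A_sec p \<otimes>\<^bsub>?A\<^esub> w \<in> carrier ?A" by (rule A_mult_closed[OF A_sec_closed w])
      have "to_G (A_sec p \<otimes>\<^bsub>?A\<^esub> w \<oplus>\<^bsub>?A\<^esub> v) = \<sigma> p \<otimes>\<^bsub>?G\<^esub> to_G w \<oplus>\<^bsub>?G\<^esub> to_G v"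
        using ring_hom_add[OF hom pw] ring_hom_mult[OF hom A_sec_closed w] add by (simp add: \<sigma>_def)
      then show ?case using add pw by (simp add: poly_span.add)
    qed
    then show ?thesis by blast
  qed
  have "carrier ?G \<subseteq> poly_span ?G \<sigma> (to_G ` W)"
  proof
    fix u assume u: "u \<in> carrier ?G"
    then have "to_G (inv_G u) \<in> poly_span ?G \<sigma> (to_G ` W)"
      using span to_inv(2)[OF u] W(3) by blast
    then show "u \<in> poly_span ?G \<sigma> (to_G ` W)" using to_inv(1)[OF u] by simp
  qed
  then have "noetherian_ring ?G" by (rule E.noetherian_if_fg[OF finite_imageI[OF W(1)] Wc])
  moreover have "nzd ?G (\<sigma> p)" if "nzd ?G (\<sigma> [:0, 1:])" "p \<noteq> 0" for p
    unfolding nzd by (rule A_nzd_sec[OF that[unfolded nzd]])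
  ultimately have "cohen_macaulay ?G \<longleftrightarrow> nzd ?G (\<sigma> [:0, 1:])"
    by (rule E.cohen_macaulay_iff_nzd)
  then show ?thesis by (simp only: nzd A_nzd_iff)
qed

end

theorem proposition5p1:
  fixes gs :: "nat list" and S :: "nat set" and R :: "'k::field fps ring" and \<mm> :: "'k fps set"
  assumes "infinite (UNIV :: 'k set)"
    and "sorted_wrt (<) gs"
    and "Gcd (set gs) = 1"
    and "\<forall>g\<in>set gs. g \<notin> semigroup_span (set gs - {g})"
    and "S = semigroup_span (set gs)"
    and "R = semigroup_ring S"
    and "\<mm> = semigroup_ideal gs"
  shows "cohen_macaulay (assoc_graded R \<mm>) \<longleftrightarrow>
    (\<forall>i<hd gs. apery S (hd gs) i \<in> max_apery_M S (hd gs) \<longrightarrow> a_num gs i = int (b_num gs i))"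
proof -
  interpret numerical_semigroup gs S "hd gs"
    using assms by unfold_locales auto
  show ?thesis
    unfolding assms(6,7) cohen_macaulay_G_iff max_apery_iff_additive ..
qed

end
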